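(* Let $p$ be a prime and let $G$ be a finite $p$-group. Then $G$ is a $\mathrm{CM}_{p-1}$-group if and only if $G$ is a GVZ-group and every character $\chi \in \mathrm{Irr}(G)$ has all of its values in the $p$-th cyclotomic field $\mathbb{Q}(\zeta_p)$, where $\zeta_p$ is a primitive $p$-th root of unity in $\mathbb{C}$.
   Context: $\mathrm{Irr}(G)$ denotes the set of irreducible complex characters of $G$. For a positive integer $n$, a finite group $G$ is a $\mathrm{CM}_n$-group if for every normal subgroup $N$ of $G$ there are at most $n$ characters $\chi \in \mathrm{Irr}(G)$ with $\ker(\chi) = N$. For $\chi \in \mathrm{Irr}(G)$, the center of $\chi$ is $Z(\chi) = \{ g \in G \mid |\chi(g)| = \chi(1) \}$. A finite group $G$ is a GVZ-group if $\chi(1) = |G:Z(\chi)|^{1/2}$ for every $\chi \in \mathrm{Irr}(G)$. *)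

theory Defs
  imports
    "HOL-Algebra.Coset"
    "HOL-Algebra.Generated_Fields"
    "HOL-Algebra.Algebraic_Closure_Type"
    "Jordan_Normal_Form.VS_Connect"
begin

definition GL :: "nat \<Rightarrow> complex mat monoid" where
  "GL n = units_of (ring_mat TYPE(complex) n ())"

definition mat_trace :: "complex mat \<Rightarrow> complex" where
  "mat_trace A = (\<Sum>i<dim_row A. A $$ (i, i))"

definition irreducible_rep ::
    "('a, 'b) monoid_scheme \<Rightarrow> nat \<Rightarrow> ('a \<Rightarrow> complex mat) \<Rightarrow> bool" where
  "irreducible_rep G n \<rho> \<longleftrightarrow>
     0 < n \<and> \<rho> \<in> hom G (GL n) \<and>
     (\<forall>W. subspace class_ring W (module_vec TYPE(complex) n) \<and>
          (\<forall>g\<in>carrier G. \<forall>w\<in>W. \<rho> g *\<^sub>v w \<in> W)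
          \<longrightarrow> W = {0\<^sub>v n} \<or> W = carrier_vec n)"

(* Characters are restricted to the carrier so that two of them are equal as HOL functions
   exactly if they agree on G; otherwise counting them would be meaningless. *)
definition Irr :: "('a, 'b) monoid_scheme \<Rightarrow> ('a \<Rightarrow> complex) set" where
  "Irr G = {restrict (\<lambda>g. mat_trace (\<rho> g)) (carrier G) | n \<rho>. irreducible_rep G n \<rho>}"

definition char_ker :: "('a, 'b) monoid_scheme \<Rightarrow> ('a \<Rightarrow> complex) \<Rightarrow> 'a set" where
  "char_ker G \<chi> = {g \<in> carrier G. \<chi> g = \<chi> \<one>\<^bsub>G\<^esub>}"

definition char_center :: "('a, 'b) monoid_scheme \<Rightarrow> ('a \<Rightarrow> complex) \<Rightarrow> 'a set" where
  "char_center G \<chi> = {g \<in> carrier G. complex_of_real (cmod (\<chi> g)) = \<chi> \<one>\<^bsub>G\<^esub>}"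

(* Finiteness is stated separately because card is 0 on infinite sets. *)
definition CM_group :: "nat \<Rightarrow> ('a, 'b) monoid_scheme \<Rightarrow> bool" where
  "CM_group n G \<longleftrightarrow>
     group G \<and> finite (carrier G) \<and>
     (\<forall>N. normal N G \<longrightarrow>
        finite {\<chi> \<in> Irr G. char_ker G \<chi> = N} \<and>
        card {\<chi> \<in> Irr G. char_ker G \<chi> = N} \<le> n)"

definition GVZ_group :: "('a, 'b) monoid_scheme \<Rightarrow> bool" where
  "GVZ_group G \<longleftrightarrow>
     group G \<and> finite (carrier G) \<and>
     (\<forall>\<chi>\<in>Irr G.
        \<chi> \<one>\<^bsub>G\<^esub> = complex_of_real (sqrt (real (card (rcosets\<^bsub>G\<^esub> (char_center G \<chi>))))))"

definition primitive_root_of_unity :: "nat \<Rightarrow> complex \<Rightarrow> bool" where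
  "primitive_root_of_unity n \<zeta> \<longleftrightarrow>
     0 < n \<and> \<zeta> ^ n = 1 \<and> (\<forall>k. 0 < k \<and> k < n \<longrightarrow> \<zeta> ^ k \<noteq> 1)"

(* The smallest subfield of the complex numbers containing z; it contains the rationals
   because every subfield does. *)
definition rat_adjoin :: "complex \<Rightarrow> complex set" where
  "rat_adjoin z = generate_field ring_of_type_algebra {z}"

end

theory Submission
  imports
    Defs
    "Jordan_Normal_Form.Spectral_Radius"
    "HOL-Algebra.Group_Action"
begin

text \<open>Let \<open>\<chi>\<close> be irreducible with kernel \<open>N\<close> and \<open>\<chi>|Z(\<chi>) = \<chi>(1) \<lambda>\<close>; by Schur's lemma \<open>Z(\<chi>)/N\<close> is
  the center of \<open>G/N\<close>, on which \<open>\<lambda>\<close> is faithful. Since \<open>\<Sum> |\<chi>(g)|\<^sup>2 = |G|\<close>, the condition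
  \<open>\<chi>(1)\<^sup>2 = |G : Z(\<chi>)|\<close> says exactly that \<open>\<chi>\<close> vanishes off \<open>Z(\<chi>)\<close>.

  If \<open>G\<close> is a \<open>CM\<close>-group for \<open>p - 1\<close>: every \<open>\<lambda>\<^sup>k\<close> with \<open>k\<close> prime to \<open>p\<close> lies below some character
  with kernel \<open>N\<close>, because a nontrivial normal subgroup of the \<open>p\<close>-group \<open>G/N\<close> meets its center. So
  \<open>\<lambda>\<close> has order at most \<open>p\<close>, as otherwise \<open>k = 1, \<dots>, p - 1, p + 1\<close> would give \<open>p\<close> characters, and
  \<open>\<chi>\<close> is the only character over \<open>\<lambda>\<close>. The character induced from \<open>\<lambda>\<close> is then a multiple of \<open>\<chi>\<close>, so
  \<open>\<chi>\<close> vanishes off \<open>Z(\<chi>)\<close>. No Galois action on characters is needed.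

  Conversely, if \<open>\<chi>\<close> vanishes off \<open>Z(\<chi>)\<close> then \<open>\<chi>\<close> is determined by \<open>N\<close> and \<open>\<lambda>\<close>. The values of \<open>\<lambda>\<close> lie in
  the \<open>p\<close>-th cyclotomic field, which contains no root of unity of order \<open>p\<^sup>2\<close>, so \<open>Z(\<chi>)/N\<close> has order at
  most \<open>p\<close> and there are at most \<open>p - 1\<close> faithful choices of \<open>\<lambda>\<close>.\<close>

section \<open>Matrices of finite order\<close>

lemma mult_mat_index:
  assumes "A \<in> carrier_mat n m" "B \<in> carrier_mat m l" "i < n" "j < l"
  shows "(A * B) $$ (i, j) = (\<Sum>k<m. A $$ (i, k) * B $$ (k, j))"
  using assms by (auto simp: scalar_prod_def atLeast0LessThan)

lemma mat_trace_eq: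
  assumes "A \<in> carrier_mat n n"
  shows "mat_trace A = (\<Sum>i<n. A $$ (i, i))"
  using assms by (simp add: mat_trace_def)

lemma mat_trace_mult_comm:
  assumes "A \<in> carrier_mat n m" "B \<in> carrier_mat m n"
  shows "mat_trace (A * B) = mat_trace (B * A)"
proof -
  have "mat_trace (A * B) = (\<Sum>i<n. \<Sum>k<m. A $$ (i, k) * B $$ (k, i))"
    using assms by (subst mat_trace_eq[of _ n]) (auto intro!: sum.cong simp: mult_mat_index simp del: index_mult_mat)
  also have "\<dots> = (\<Sum>k<m. \<Sum>i<n. B $$ (k, i) * A $$ (i, k))"
    by (subst sum.swap) (simp add: mult.commute)
  also have "\<dots> = mat_trace (B * A)"
    using assms by (subst mat_trace_eq[of _ m]) (auto intro!: sum.cong simp: mult_mat_index simp del: index_mult_mat)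
  finally show ?thesis .
qed

lemma mat_trace_similar:
  assumes "A \<in> carrier_mat n n" "P \<in> carrier_mat n n" "Q \<in> carrier_mat n n" "P * Q = 1\<^sub>m n"
  shows "mat_trace (Q * A * P) = mat_trace A"
proof -
  have "mat_trace (Q * (A * P)) = mat_trace (A * P * Q)"
    using assms by (intro mat_trace_mult_comm[of _ n n]) auto
  also have "A * P * Q = A" using assms by (simp add: assoc_mult_mat[of _ n n _ n _ n])
  finally show ?thesis using assms by (simp add: assoc_mult_mat[of _ n n _ n _ n])
qed

lemma mat_trace_one [simp]: "mat_trace (1\<^sub>m n) = of_nat n"
  by (simp add: mat_trace_def)

lemma mat_trace_smult [simp]: "mat_trace (c \<cdot>\<^sub>m A) = c * mat_trace A" if "A \<in> carrier_mat n n"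
  using that by (simp add: mat_trace_def sum_distrib_left)

text \<open>The two claims go together: the diagonal entries of the next power are found from the
  vanishing of the current power below the diagonal.\<close>

lemma upper_triangular_pow:
  fixes T :: "'a :: comm_ring_1 mat"
  assumes T: "T \<in> carrier_mat n n" and ut: "upper_triangular T"
  shows "i < n \<Longrightarrow> j < n \<Longrightarrow> j < i \<Longrightarrow> (T ^\<^sub>m m) $$ (i, j) = 0"
    and "i < n \<Longrightarrow> (T ^\<^sub>m m) $$ (i, i) = (T $$ (i, i)) ^ m"
proof (induction m arbitrary: i j)
  case (Suc m)
  have z: "T $$ (i, j) = 0" if "i < n" "j < i" for i j
    using ut T that by auto
  {
    case 1
    have "(T ^\<^sub>m Suc m) $$ (i, j) = (\<Sum>k<n. (T ^\<^sub>m m) $$ (i, k) * T $$ (k, j))"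
      using T 1 by (simp add: mult_mat_index[of _ n n _ n] del: index_mult_mat)
    also have "\<dots> = 0"
    proof (rule sum.neutral, intro ballI)
      fix k assume "k \<in> {..<n}"
      then show "(T ^\<^sub>m m) $$ (i, k) * T $$ (k, j) = 0"
        using Suc.IH(1)[of i k] 1 z[of k j] by (cases "k < i") auto
    qed
    finally show ?case .
  next
    case 2
    have "(T ^\<^sub>m Suc m) $$ (i, i) = (\<Sum>k<n. (T ^\<^sub>m m) $$ (i, k) * T $$ (k, i))"
      using T 2 by (simp add: mult_mat_index[of _ n n _ n] del: index_mult_mat)
    also have "\<dots> = (\<Sum>k<n. if k = i then (T $$ (i, i)) ^ Suc m else 0)"
    proof (rule sum.cong)
      fix k assume "k \<in> {..<n}"
      then show "(T ^\<^sub>m m) $$ (i, k) * T $$ (k, i) = (if k = i then (T $$ (i, i)) ^ Suc m else 0)"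
        using Suc.IH(1)[of i k] Suc.IH(2)[of i] 2 z[of k i] by (cases k i rule: linorder_cases) auto
    qed simp
    also have "\<dots> = (T $$ (i, i)) ^ Suc m" using 2 by simp
    finally show ?case .
  }
qed (use T in auto)

text \<open>Up to the factor \<open>c\<close> the matrix is unipotent, and in characteristic 0 a
  nontrivial unipotent matrix has infinite order. The superdiagonals are shown to vanish one after
  the other, by increasing distance \<open>s\<close> from the diagonal.\<close>

lemma unipotent_of_finite_order:
  fixes T :: "complex mat"
  assumes T: "T \<in> carrier_mat n n" and ut: "upper_triangular T"
    and diag: "\<And>i. i < n \<Longrightarrow> T $$ (i, i) = c"
    and k: "T ^\<^sub>m k = 1\<^sub>m n" "0 < k"
  shows "T = c \<cdot>\<^sub>m 1\<^sub>m n"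
proof (cases "n = 0")
  case False
  have "c ^ k = 1"
    using upper_triangular_pow(2)[OF T ut, of 0 k] k diag[of 0] False by simp
  then have c: "c \<noteq> 0" using k by (auto simp: power_0_left)
  have ltz: "T $$ (i, j) = 0" if "i < n" "j < i" for i j
    using ut T that by auto
  have off: "T $$ (i, i + s) = 0" if "0 < s" "i + s < n" for s i
    using that
  proof (induction s arbitrary: i rule: less_induct)
    case (less s)
    have z: "T $$ (a, b) = 0" if "a < n" "b < n" "a \<noteq> b" "b < a + s" for a b
      using ltz[of a b] less.IH[of "b - a" a] that by (cases "a < b") auto
    have P: "((T ^\<^sub>m m) $$ (a, b) = (if a = b then c ^ m else 0))"
      if "a < n" "b < n" "b < a + s" for m a b
      using that
    proof (induction m arbitrary: a b)
      case 0
      then show ?case using T by auto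
    next
      case (Suc m)
      have "(T ^\<^sub>m Suc m) $$ (a, b) = (\<Sum>k<n. (T ^\<^sub>m m) $$ (a, k) * T $$ (k, b))"
        using T Suc.prems by (simp add: mult_mat_index[of _ n n _ n] del: index_mult_mat)
      also have "\<dots> = (\<Sum>k<n. if k = b then (if a = b then c ^ Suc m else 0) else 0)"
      proof (rule sum.cong)
        fix k assume "k \<in> {..<n}"
        then show "(T ^\<^sub>m m) $$ (a, k) * T $$ (k, b) = (if k = b then (if a = b then c ^ Suc m else 0) else 0)"
          using Suc.IH[of a k] Suc.prems z[of k b] diag[of b] ltz[of k b]
            upper_triangular_pow(1)[OF T ut, of a k m]
          by (cases "b < k"; cases "k < a"; cases "k = b") auto
      qed simp
      also have "\<dots> = (if a = b then c ^ Suc m else 0)" using Suc.prems by simp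
      finally show ?case .
    qed
    \<comment> \<open>At distance exactly \<open>s\<close> only the summands \<open>k = i\<close>
      and \<open>k = i + s\<close> survive, which produces the derivative of \<open>c ^ m\<close> as
      a factor. At \<open>m = 0\<close> the truncated exponent is harmless because
      \<open>of_nat m\<close> is 0.\<close>
    have Q: "(T ^\<^sub>m m) $$ (i, i + s) = of_nat m * c ^ (m - 1) * T $$ (i, i + s)" for m
    proof (induction m)
      case 0
      then show ?case using T less.prems by auto
    next
      case (Suc m)
      have "(T ^\<^sub>m Suc m) $$ (i, i + s) = (\<Sum>k<n. (T ^\<^sub>m m) $$ (i, k) * T $$ (k, i + s))"
        using T less.prems by (simp add: mult_mat_index[of _ n n _ n] del: index_mult_mat)
      also have "\<dots> = (\<Sum>k<n. (if k = i then c ^ m * T $$ (i, i + s) else 0) +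
          (if k = i + s then of_nat m * c ^ (m - 1) * T $$ (i, i + s) * c else 0))"
      proof (rule sum.cong)
        fix k assume "k \<in> {..<n}"
        then show "(T ^\<^sub>m m) $$ (i, k) * T $$ (k, i + s) = (if k = i then c ^ m * T $$ (i, i + s) else 0) +
          (if k = i + s then of_nat m * c ^ (m - 1) * T $$ (i, i + s) * c else 0)"
          using Suc.IH P[of i k m] z[of k "i + s"] diag[of "i + s"] ltz[of k "i + s"] less.prems
            upper_triangular_pow(1)[OF T ut, of i k m]
          by (cases "i + s < k"; cases "k < i"; cases "k = i"; cases "k = i + s") auto
      qed simp
      also have "\<dots> = c ^ m * T $$ (i, i + s) + of_nat m * c ^ (m - 1) * T $$ (i, i + s) * c"
        using less.prems by (simp add: sum.distrib)
      also have "\<dots> = of_nat (Suc m) * c ^ (Suc m - 1) * T $$ (i, i + s)"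
        by (cases m) (auto simp: algebra_simps)
      finally show ?case .
    qed
    have "(T ^\<^sub>m k) $$ (i, i + s) = 0" using k less.prems by simp
    then show "T $$ (i, i + s) = 0" using Q[of k] k c by simp
  qed
  show ?thesis
  proof (rule eq_matI)
    fix i j assume "i < dim_row (c \<cdot>\<^sub>m 1\<^sub>m n)" "j < dim_col (c \<cdot>\<^sub>m 1\<^sub>m n)"
    then show "T $$ (i, j) = (c \<cdot>\<^sub>m 1\<^sub>m n) $$ (i, j)"
      using ltz[of i j] off[of "j - i" i] diag[of i] by (cases i j rule: linorder_cases) auto
  qed (use T in auto)
qed (use T in \<open>auto intro!: eq_matI\<close>)

text \<open>By Schur triangularization, \<open>e\<close> is the diagonal of a triangular matrix
  similar to \<open>A\<close>. Diagonalizability is bypassed: the last claim concerns a single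
  eigenvalue, where finite order already makes the triangular matrix scalar.\<close>

lemma finite_order_matrix_spectrum:
  fixes A :: "complex mat"
  assumes A: "A \<in> carrier_mat n n" and k: "A ^\<^sub>m k = 1\<^sub>m n" "0 < k"
  obtains e where "\<And>i. i < n \<Longrightarrow> (e i) ^ k = 1"
    and "\<And>m. mat_trace (A ^\<^sub>m m) = (\<Sum>i<n. (e i) ^ m)"
    and "\<And>c. (\<And>i. i < n \<Longrightarrow> e i = c) \<Longrightarrow> A = c \<cdot>\<^sub>m 1\<^sub>m n"
proof -
  obtain es where "char_poly A = (\<Prod>a\<leftarrow>es. [:- a, 1:])" using char_poly_factorized[OF A] by blast
  from schur_decomposition_exists[OF A this]
  obtain T where T: "T \<in> carrier_mat n n" and ut: "upper_triangular T" and "similar_mat A T" by blast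
  then obtain P Q where sim: "similar_mat_wit A T P Q" unfolding similar_mat_def by blast
  note w = similar_mat_witD2[OF A sim]
  have tr: "mat_trace (A ^\<^sub>m m) = mat_trace (T ^\<^sub>m m)" for m
    using similar_mat_wit_pow_id[OF sim, of m] mat_trace_similar[of "T ^\<^sub>m m" n Q P] w T
    by (simp add: pow_carrier_mat)
  have Tk: "T ^\<^sub>m k = 1\<^sub>m n"
  proof -
    have "T ^\<^sub>m k = Q * A ^\<^sub>m k * P"
      using similar_mat_wit_pow_id[OF similar_mat_wit_sym[OF sim]] .
    then show ?thesis using k w by simp
  qed
  show ?thesis
  proof
    fix i assume "i < n"
    then show "(T $$ (i, i)) ^ k = 1"
      using upper_triangular_pow(2)[OF T ut, of i k] Tk by simp
  next
    fix m
    have "T ^\<^sub>m m \<in> carrier_mat n n" using T by auto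
    then show "mat_trace (A ^\<^sub>m m) = (\<Sum>i<n. T $$ (i, i) ^ m)"
      using upper_triangular_pow(2)[OF T ut] by (simp add: tr mat_trace_eq)
  next
    fix c assume "\<And>i. i < n \<Longrightarrow> T $$ (i, i) = c"
    then have Tc: "T = c \<cdot>\<^sub>m 1\<^sub>m n" using unipotent_of_finite_order[OF T ut _ Tk k(2)] by blast
    have "A = P * (c \<cdot>\<^sub>m 1\<^sub>m n) * Q" using w Tc by simp
    also have "\<dots> = c \<cdot>\<^sub>m 1\<^sub>m n"
      using w by (simp only: mult_smult_distrib[OF w(6) one_carrier_mat] mult_smult_assoc_mat[OF w(6) w(7)]
          right_mult_one_mat[OF w(6)])
    finally show "A = c \<cdot>\<^sub>m 1\<^sub>m n" .
  qed
qed

text \<open>This is the equality case of the triangle inequality. Divided by the mean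
  \<open>c\<close>, which has modulus 1, the \<open>n\<close> summands have real parts at most 1
  that add up to \<open>n\<close>, so each of them is 1.\<close>

lemma sum_unit_complex_eq_card:
  fixes e :: "nat \<Rightarrow> complex"
  assumes u: "\<And>i. i < n \<Longrightarrow> cmod (e i) = 1" and s: "cmod (\<Sum>i<n. e i) = n" and "i < n" "j < n"
  shows "e i = e j"
proof -
  define s where "s = (\<Sum>i<n. e i)"
  have s0: "s \<noteq> 0" using s \<open>i < n\<close> unfolding s_def by auto
  define c where "c = s / of_nat n"
  have n0: "0 < n" using \<open>i < n\<close> by auto
  have c1: "cmod c = 1" using assms n0 unfolding c_def s_def by (simp add: norm_divide)
  have re: "Re (e k * cnj c) \<le> 1" if "k < n" for k
    using complex_Re_le_cmod[of "e k * cnj c"] u[OF that] c1 by (simp add: norm_mult)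
  have "(\<Sum>k<n. e k * cnj c) = s * cnj c" by (simp add: s_def sum_distrib_right)
  also have "\<dots> = of_nat n * (c * cnj c)" using n0 by (simp add: c_def)
  also have "\<dots> = of_nat n" using c1 by (simp add: complex_norm_square[symmetric])
  finally have "(\<Sum>k<n. Re (e k * cnj c)) = n"
    by (metis Re_sum complex_Re_of_nat)
  then have "(\<Sum>k<n. 1 - Re (e k * cnj c)) = 0" by (simp add: sum_subtractf)
  then have one: "Re (e k * cnj c) = 1" if "k < n" for k
    using re that sum_nonneg_eq_0_iff[of "{..<n}" "\<lambda>k. 1 - Re (e k * cnj c)"] by auto
  have eq: "e k = c" if "k < n" for k
  proof -
    have m: "cmod (e k * cnj c) = 1" using u[OF that] c1 by (simp add: norm_mult)
    have "Im (e k * cnj c) = 0"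
      using m one[OF that] by (simp add: cmod_def)
    then have "e k * cnj c = 1" using one[OF that] by (simp add: complex_eq_iff)
    then have "e k * (cnj c * c) = c" by (simp add: mult.assoc[symmetric])
    moreover have "cnj c * c = 1"
      using c1 complex_norm_square[of c] by (simp add: mult.commute)
    ultimately show ?thesis by simp
  qed
  show ?thesis using eq assms by simp
qed

text \<open>The eigenvalues have modulus 1, so raising them to the power \<open>k - 1\<close>
  inverts and hence conjugates them. A trace of modulus \<open>n\<close> forces all of them to
  agree.\<close>

lemma finite_order_matrix_trace:
  fixes A :: "complex mat"
  assumes A: "A \<in> carrier_mat n n" and k: "A ^\<^sub>m k = 1\<^sub>m n" "0 < k"
  shows "mat_trace (A ^\<^sub>m (k - 1)) = cnj (mat_trace A)"
    and "cmod (mat_trace A) = n \<Longrightarrow> \<exists>c. A = c \<cdot>\<^sub>m 1\<^sub>m n"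
proof -
  obtain e where e: "\<And>i. i < n \<Longrightarrow> (e i) ^ k = 1"
    "\<And>m. mat_trace (A ^\<^sub>m m) = (\<Sum>i<n. (e i) ^ m)"
    "\<And>c. (\<And>i. i < n \<Longrightarrow> e i = c) \<Longrightarrow> A = c \<cdot>\<^sub>m 1\<^sub>m n"
    using finite_order_matrix_spectrum[OF A k] by blast
  have u: "cmod (e i) = 1" if "i < n" for i
    using e(1)[OF that] k(2) by (metis norm_power norm_one power_eq_1_iff norm_ge_zero abs_of_nonneg real_norm_def neq0_conv power_eq_1_iff)
  have cn: "(e i) ^ (k - 1) = cnj (e i)" if "i < n" for i
  proof -
    have "e i * (e i) ^ (k - 1) = e i * cnj (e i)"
      using e(1)[OF that] k(2) u[OF that] by (simp add: power_eq_if complex_norm_square[symmetric])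
    then show ?thesis using u[OF that] by (metis mult_cancel_left norm_zero zero_neq_one)
  qed
  have tr: "mat_trace A = (\<Sum>i<n. e i)" using e(2)[of 1] A by simp
  show "mat_trace (A ^\<^sub>m (k - 1)) = cnj (mat_trace A)"
    using e(2)[of "k - 1"] tr cn by (simp add: cnj_sum)
  show "\<exists>c. A = c \<cdot>\<^sub>m 1\<^sub>m n" if "cmod (mat_trace A) = n"
    using sum_unit_complex_eq_card[of n e] u that tr e(3)[of "e 0"]
    by (cases "n = 0") (metis e(3) less_nat_zero_code neq0_conv)+
qed

section \<open>Representations and Schur orthogonality\<close>

text \<open>The columns of \<open>P\<close> are a basis of \<open>W\<close> completed to a basis of
  the whole space, and \<open>Q\<close> reads off coordinates. In such a basis every matrix that
  preserves \<open>W\<close> is block upper triangular.\<close>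

lemma adapted_basis:
  fixes W :: "complex vec set"
  assumes sub: "subspace class_ring W (module_vec TYPE(complex) n)"
    and nz: "W \<noteq> {0\<^sub>v n}" and nf: "W \<noteq> carrier_vec n"
  obtains d P Q where "0 < d" "d < n" "P \<in> carrier_mat n n" "Q \<in> carrier_mat n n"
    "P * Q = 1\<^sub>m n" "Q * P = 1\<^sub>m n" "\<And>j. j < d \<Longrightarrow> col P j \<in> W"
    "\<And>w i. w \<in> W \<Longrightarrow> d \<le> i \<Longrightarrow> i < n \<Longrightarrow> (Q *\<^sub>v w) $ i = 0"
proof -
  interpret vec_space "TYPE(complex)" n .
  have Wm: "submodule class_ring W V" using sub unfolding subspace_def by auto
  then have Wc: "W \<subseteq> carrier_vec n" unfolding submodule_def by auto
  have bound: "finite S \<and> card S \<le> n" if "S \<subseteq> carrier_vec n" "lin_indpt S" for S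
    using li_le_dim[OF fin_dim that] dim_is_n by auto
  have "\<exists>B. finite B \<and> maximal B (\<lambda>S. S \<subseteq> W \<and> lin_indpt S)"
    by (rule maximal_exists[of _ n "{}"]) (use bound Wc in \<open>auto simp: lin_dep_def\<close>)
  then obtain B where B: "finite B" "B \<subseteq> W" "lin_indpt B"
    and Bmax: "\<And>S. B \<subseteq> S \<Longrightarrow> S \<subseteq> W \<Longrightarrow> lin_indpt S \<Longrightarrow> S = B"
    unfolding maximal_def by metis
  \<comment> \<open>Adjoining to \<open>B\<close> a vector of \<open>W\<close> outside its span
    would leave it independent, against maximality.\<close>
  have spanB: "span B = W"
  proof
    show "span B \<subseteq> W" by (rule span_is_subset[OF B(2) Wm])
    show "W \<subseteq> span B"
    proof
      fix w assume w: "w \<in> W"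
      show "w \<in> span B"
      proof (rule ccontr)
        assume n: "w \<notin> span B"
        then have wB: "w \<notin> B" using in_own_span[of B] B Wc by auto
        then have "lin_indpt (B \<union> {w})"
          using lin_dep_iff_in_span[of B w] B Wc w n by auto
        then show False using Bmax[of "B \<union> {w}"] w wB B by auto
      qed
    qed
  qed
  have "\<exists>C. finite C \<and> maximal C (\<lambda>S. B \<subseteq> S \<and> S \<subseteq> carrier_vec n \<and> lin_indpt S)"
    by (rule maximal_exists[of _ n B]) (use bound Wc B in auto)
  then obtain C where C: "finite C" "B \<subseteq> C" "C \<subseteq> carrier_vec n" "lin_indpt C"
    and Cmax: "\<And>S. C \<subseteq> S \<Longrightarrow> S \<subseteq> carrier_vec n \<Longrightarrow> lin_indpt S \<Longrightarrow> S = C"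
    unfolding maximal_def by (smt (verit, best) subset_trans)
  have basC: "basis C"
    by (rule max_li_is_basis) (use C Cmax in \<open>auto simp: maximal_def\<close>)
  then have spanC: "span C = carrier_vec n" unfolding basis_def by auto
  have cardC: "card C = n" using dim_basis[OF C(1) basC] dim_is_n by simp
  obtain ws where ws: "set ws = B" "distinct ws" using finite_distinct_list[OF B(1)] by blast
  have "finite (C - B)" using C by auto
  from finite_distinct_list[OF this] obtain us where us: "set us = C - B" "distinct us" by blast
  define vs where "vs = ws @ us"
  have vs: "set vs = C" "distinct vs" using ws us C unfolding vs_def by auto
  then have len: "length vs = n" using cardC distinct_card by fastforce
  define P where "P = mat_of_cols n vs"
  have P: "P \<in> carrier_mat n n" using len unfolding P_def by auto
  \<comment> \<open>The columns of \<open>P\<close> span the space, so every unit vector is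
    \<open>P\<close> applied to a vector of coefficients. These vectors are the columns of a right
    inverse, which is two-sided because \<open>P\<close> is square.\<close>
  have "\<exists>x. x \<in> carrier_vec n \<and> P *\<^sub>v x = unit_vec n i" if "i < n" for i
  proof -
    have "unit_vec n i \<in> span_list vs" using spanC span_list_as_span[of vs] vs C by simp
    then obtain c where "unit_vec n i = lincomb_list c vs" unfolding span_list_def by blast
    then have "unit_vec n i = P *\<^sub>v vec (length vs) c"
      unfolding P_def using vs C by (subst lincomb_list_as_mat_mult[symmetric]) auto
    then show ?thesis using len by (intro exI[of _ "vec (length vs) c"]) auto
  qed
  then obtain x where x: "\<And>i. i < n \<Longrightarrow> x i \<in> carrier_vec n" "\<And>i. i < n \<Longrightarrow> P *\<^sub>v x i = unit_vec n i"
    by metis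
  define Q where "Q = mat_of_cols n (map x [0..<n])"
  have Q: "Q \<in> carrier_mat n n" unfolding Q_def by auto
  have colQ: "col Q i = x i" if "i < n" for i
    using that x unfolding Q_def by (simp add: col_mat_of_cols)
  have PQ: "P * Q = 1\<^sub>m n"
  proof (rule mat_col_eqI)
    fix i assume "i < dim_col (1\<^sub>m n :: complex mat)"
    then show "col (P * Q) i = col (1\<^sub>m n) i"
      using col_mult2[OF P Q] x(2) colQ by simp
  qed (use P Q in auto)
  have QP: "Q * P = 1\<^sub>m n" by (rule mat_mult_left_right_inverse[OF P Q PQ])
  define d where "d = length ws"
  have colP: "col P j = ws ! j" if "j < d" for j
    using that vs C len unfolding P_def vs_def d_def
    by (subst col_mat_of_cols) (auto simp: nth_append)
  have dle: "d \<le> n" using len unfolding vs_def d_def by auto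
  have d0: "0 < d"
  proof (rule ccontr)
    assume "\<not> 0 < d"
    then have "B = {}" using ws unfolding d_def by auto
    then show False using spanB nz span_empty by auto
  qed
  have dn: "d < n"
  proof (rule ccontr)
    assume "\<not> d < n"
    then have "us = []" using len unfolding vs_def d_def by auto
    then have "C = B" using us C by auto
    then show False using spanB spanC nf by simp
  qed
  have rowQ: "row Q i \<in> carrier_vec n" if "i < n" for i using that Q by auto
  \<comment> \<open>The vectors whose coordinates from \<open>d\<close> on vanish form a subspace;
    it contains \<open>B\<close> and hence its span \<open>W\<close>.\<close>
  have "submodule class_ring {w \<in> carrier_vec n. \<forall>i. d \<le> i \<and> i < n \<longrightarrow> (Q *\<^sub>v w) $ i = 0} V"
    using Q by (intro submodule.intro)
      (auto simp: module_vec_simps mult_add_distrib_mat_vec[of Q n n] mult_mat_vec[of Q n n]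
        scalar_prod_add_distrib[OF rowQ], unfold_locales)
  moreover have "B \<subseteq> {w \<in> carrier_vec n. \<forall>i. d \<le> i \<and> i < n \<longrightarrow> (Q *\<^sub>v w) $ i = 0}"
  proof
    fix w assume "w \<in> B"
    then obtain j where j: "j < d" "w = ws ! j" using ws unfolding d_def by (metis in_set_conv_nth)
    have "Q *\<^sub>v w = col (Q * P) j" using j colP[of j] dle col_mult2[OF Q P, of j] by simp
    then have "Q *\<^sub>v w = unit_vec n j" using QP j dle by simp
    then show "w \<in> {w \<in> carrier_vec n. \<forall>i. d \<le> i \<and> i < n \<longrightarrow> (Q *\<^sub>v w) $ i = 0}"
      using j dle \<open>w \<in> B\<close> B Wc by auto
  qed
  ultimately have Wz: "W \<subseteq> {w \<in> carrier_vec n. \<forall>i. d \<le> i \<and> i < n \<longrightarrow> (Q *\<^sub>v w) $ i = 0}"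
    using span_is_subset spanB by blast
  show ?thesis
  proof
    show "col P j \<in> W" if "j < d" for j using colP[OF that] that ws B unfolding d_def by auto
    show "(Q *\<^sub>v w) $ i = 0" if "w \<in> W" "d \<le> i" "i < n" for w i using Wz that by blast
  qed (use d0 dn P Q PQ QP in auto)
qed

section \<open>Matrix representations and Schur's lemma\<close>

definition matrix_rep :: "('a, 'b) monoid_scheme \<Rightarrow> nat \<Rightarrow> ('a \<Rightarrow> complex mat) \<Rightarrow> bool" where
  "matrix_rep G n \<rho> \<longleftrightarrow> (\<forall>g\<in>carrier G. \<rho> g \<in> carrier_mat n n) \<and>
     (\<forall>g\<in>carrier G. \<forall>h\<in>carrier G. \<rho> (g \<otimes>\<^bsub>G\<^esub> h) = \<rho> g * \<rho> h) \<and> \<rho> \<one>\<^bsub>G\<^esub> = 1\<^sub>m n"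

lemma matrix_repD:
  assumes "matrix_rep G n \<rho>"
  shows "g \<in> carrier G \<Longrightarrow> \<rho> g \<in> carrier_mat n n"
    and "g \<in> carrier G \<Longrightarrow> h \<in> carrier G \<Longrightarrow> \<rho> (g \<otimes>\<^bsub>G\<^esub> h) = \<rho> g * \<rho> h"
    and "\<rho> \<one>\<^bsub>G\<^esub> = 1\<^sub>m n"
  using assms by (auto simp: matrix_rep_def)

text \<open>Since \<open>\<rho> (inv g)\<close> is an inverse of \<open>\<rho> g\<close>,
  invertibility comes for free and plain matrices can replace the unit group.\<close>

lemma (in group) hom_GL_iff: "\<rho> \<in> hom G (GL n) \<longleftrightarrow> matrix_rep G n \<rho>"
proof
  let ?R = "ring_mat TYPE(complex) n ()"
  interpret R: ring ?R by (rule ring_mat)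
  have carr: "carrier (GL n) \<subseteq> carrier_mat n n"
    by (auto simp: GL_def units_of_def Units_def ring_mat_simps)
  have mult: "monoid.mult (GL n) = (*)" and one: "one (GL n) = 1\<^sub>m n"
    by (simp_all add: GL_def units_of_def ring_mat_simps)
  {
    assume h: "\<rho> \<in> hom G (GL n)"
    have "group (GL n)" unfolding GL_def by (rule R.units_group)
    then have "\<rho> \<one> = 1\<^sub>m n" using hom_one[OF h is_group] one by simp
    then show "matrix_rep G n \<rho>" using h carr mult by (auto simp: matrix_rep_def hom_def)
  next
    assume r: "matrix_rep G n \<rho>"
    note r = matrix_repD[OF r]
    have "\<rho> g \<in> carrier (GL n)" if g: "g \<in> carrier G" for g
    proof -
      have "\<rho> (inv g) * \<rho> g = 1\<^sub>m n" "\<rho> g * \<rho> (inv g) = 1\<^sub>m n"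
        using g r(2)[of "inv g" g] r(2)[of g "inv g"] r(3) by auto
      then show ?thesis using r(1) g
        by (auto simp: GL_def units_of_def Units_def ring_mat_simps intro!: bexI[of _ "\<rho> (inv g)"])
    qed
    then show "\<rho> \<in> hom G (GL n)" using r mult by (auto simp: hom_def)
  }
qed

lemma (in group) irreducible_rep_matrix_rep:
  "irreducible_rep G n \<rho> \<Longrightarrow> matrix_rep G n \<rho>"
  by (simp add: irreducible_rep_def hom_GL_iff)

lemma subspace_module_vecI:
  assumes "W \<subseteq> carrier_vec n" "0\<^sub>v n \<in> W" "\<And>v w. v \<in> W \<Longrightarrow> w \<in> W \<Longrightarrow> v + w \<in> W"
    and "\<And>c v. v \<in> W \<Longrightarrow> c \<cdot>\<^sub>v v \<in> W"
  shows "subspace class_ring W (module_vec TYPE(complex) n)"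
proof -
  interpret vec_space "TYPE(complex)" n .
  have "submodule class_ring W V"
    using assms by (intro submodule.intro) (auto simp: module_vec_simps, unfold_locales)
  then show ?thesis unfolding subspace_def using vec_vs by blast
qed

text \<open>An eigenspace of \<open>A\<close> is invariant and nonzero, hence the whole space. An
  eigenvalue exists over the complex numbers because \<open>n\<close> is positive.\<close>

lemma (in group) schur_scalar:
  assumes irr: "irreducible_rep G n \<rho>" and A: "A \<in> carrier_mat n n"
    and comm: "\<And>g. g \<in> carrier G \<Longrightarrow> A * \<rho> g = \<rho> g * A"
  obtains c where "A = c \<cdot>\<^sub>m 1\<^sub>m n"
proof -
  note r = matrix_repD[OF irreducible_rep_matrix_rep[OF irr]]
  have n: "0 < n" using irr by (simp add: irreducible_rep_def)
  obtain c where "eigenvalue A c" using spectrum_non_empty[OF A n] unfolding spectrum_def by auto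
  then obtain v where v: "v \<in> carrier_vec n" "v \<noteq> 0\<^sub>v n" "A *\<^sub>v v = c \<cdot>\<^sub>v v"
    using A unfolding eigenvalue_def eigenvector_def by auto
  define W where "W = {w \<in> carrier_vec n. A *\<^sub>v w = c \<cdot>\<^sub>v w}"
  have "subspace class_ring W (module_vec TYPE(complex) n)"
    using A by (intro subspace_module_vecI)
      (auto simp: W_def mult_add_distrib_mat_vec[of A n n] mult_mat_vec[of A n n] smult_add_distrib_vec[of _ n]
        smult_smult_assoc mult.commute)
  moreover have "\<rho> g *\<^sub>v w \<in> W" if g: "g \<in> carrier G" and w: "w \<in> W" for g w
  proof -
    have w': "w \<in> carrier_vec n" "A *\<^sub>v w = c \<cdot>\<^sub>v w" using w by (auto simp: W_def)
    have "A *\<^sub>v (\<rho> g *\<^sub>v w) = (A * \<rho> g) *\<^sub>v w"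
      using A r(1)[OF g] w' by simp
    also have "\<dots> = \<rho> g *\<^sub>v (A *\<^sub>v w)"
      using A r(1)[OF g] w' comm[OF g] by simp
    also have "\<dots> = c \<cdot>\<^sub>v (\<rho> g *\<^sub>v w)"
      using mult_mat_vec[OF r(1)[OF g] w'(1)] w'(2) by simp
    finally show ?thesis using r(1)[OF g] w' by (auto simp: W_def)
  qed
  ultimately have "W = {0\<^sub>v n} \<or> W = carrier_vec n"
    using irr unfolding irreducible_rep_def by blast
  then have W: "A *\<^sub>v w = c \<cdot>\<^sub>v w" if "w \<in> carrier_vec n" for w
    using v that unfolding W_def by auto
  have "A = c \<cdot>\<^sub>m 1\<^sub>m n"
  proof (rule mat_col_eqI)
    fix i assume "i < dim_col (c \<cdot>\<^sub>m 1\<^sub>m n)"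
    then have i: "i < n" by simp
    have "col A i = A *\<^sub>v unit_vec n i" using A i by (intro eq_vecI) auto
    then show "col A i = col (c \<cdot>\<^sub>m 1\<^sub>m n) i" using W[of "unit_vec n i"] i by simp
  qed (use A in auto)
  then show ?thesis using that by blast
qed

lemma (in group) matrix_rep_pow:
  assumes "matrix_rep G n \<rho>" "g \<in> carrier G"
  shows "\<rho> (g [^] (k :: nat)) = \<rho> g ^\<^sub>m k"
  using assms matrix_repD[OF assms(1)] by (induction k) auto

lemma (in group) matrix_rep_finite_order:
  assumes "finite (carrier G)" "matrix_rep G n \<rho>" "g \<in> carrier G"
  shows "\<rho> g ^\<^sub>m Coset.order G = 1\<^sub>m n" "0 < Coset.order G"
  using matrix_rep_pow[OF assms(2,3), of "Coset.order G"] pow_order_eq_1[OF assms(3)] matrix_repD[OF assms(2)] assms(1)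
  by (auto simp: order_gt_0_iff_finite)

lemma (in group) mat_trace_inv:
  assumes fin: "finite (carrier G)" and r: "matrix_rep G n \<rho>" and g: "g \<in> carrier G"
  shows "mat_trace (\<rho> (inv g)) = cnj (mat_trace (\<rho> g))"
proof -
  note o = matrix_rep_finite_order[OF fin r g]
  have "g \<otimes> g [^] (Coset.order G - 1) = \<one>"
    using pow_order_eq_1[OF g] o(2) g nat_pow_Suc2[OF g, of "Coset.order G - 1"] by simp
  then have "inv g = g [^] (Coset.order G - 1)" using g by (metis inv_equality inv_inv inv_closed nat_pow_closed)
  then show ?thesis
    using matrix_rep_pow[OF r g, of "Coset.order G - 1"] finite_order_matrix_trace(1)[OF matrix_repD(1)[OF r g] o] by simp
qed

lemma (in group) scalar_of_cmod_trace:
  assumes "finite (carrier G)" "matrix_rep G n \<rho>" "g \<in> carrier G" "cmod (mat_trace (\<rho> g)) = n"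
  obtains c where "\<rho> g = c \<cdot>\<^sub>m 1\<^sub>m n"
  using finite_order_matrix_trace(2)[OF matrix_repD(1)[OF assms(2,3)] matrix_rep_finite_order[OF assms(1-3)] assms(4)]
  by blast

text \<open>Schur orthogonality for a single representation: expanding both traces leaves the sums
  \<open>S a a b b\<close>, of which only those with \<open>a = b\<close> survive, each equal to the
  group order divided by \<open>n\<close>.\<close>

lemma (in group) irreducible_char_norm:
  assumes fin: "finite (carrier G)" and irr: "irreducible_rep G n \<rho>"
  shows "(\<Sum>g\<in>carrier G. (cmod (mat_trace (\<rho> g)))\<^sup>2) = real (Coset.order G)"
proof -
  note rep = irreducible_rep_matrix_rep[OF irr]
  note r = matrix_repD[OF rep]
  have n: "0 < n" using irr by (simp add: irreducible_rep_def)
  define S where "S a j k b = (\<Sum>g\<in>carrier G. \<rho> g $$ (a, j) * \<rho> (inv g) $$ (k, b))" for a j k b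
  have sc: "\<exists>c. \<forall>a<n. \<forall>b<n. S a j k b = (if a = b then c else 0)" if "j < n" "k < n" for j k
  proof -
    \<comment> \<open>\<open>M\<close> is the sum of \<open>\<rho> g * E * \<rho> (inv g)\<close>
      over the group, where \<open>E\<close> is the matrix unit at \<open>(j, k)\<close>. It
      commutes with every \<open>\<rho> h\<close>, so Schur's lemma makes it scalar.\<close>
    define M where "M = mat n n (\<lambda>(a, b). S a j k b)"
    have M: "M \<in> carrier_mat n n" by (simp add: M_def)
    have "M * \<rho> h = \<rho> h * M" if h: "h \<in> carrier G" for h
    proof (rule eq_matI)
      fix a b assume "a < dim_row (\<rho> h * M)" "b < dim_col (\<rho> h * M)"
      then have a: "a < n" and b: "b < n" using r(1)[OF h] M by auto
      have "(\<rho> h * M) $$ (a, b) = (\<Sum>c<n. \<rho> h $$ (a, c) * S c j k b)"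
        using mult_mat_index[OF r(1)[OF h] M a b] b by (simp add: M_def)
      also have "\<dots> = (\<Sum>g\<in>carrier G. (\<Sum>c<n. \<rho> h $$ (a, c) * \<rho> g $$ (c, j)) * \<rho> (inv g) $$ (k, b))"
        unfolding S_def sum_distrib_left sum_distrib_right
        by (subst sum.swap) (simp add: mult.assoc)
      also have "\<dots> = (\<Sum>g\<in>carrier G. \<rho> (h \<otimes> g) $$ (a, j) * \<rho> (inv g) $$ (k, b))"
        using mult_mat_index[OF r(1)[OF h] r(1) a \<open>j < n\<close>] r(2)[OF h] by (intro sum.cong) simp_all
      \<comment> \<open>Reindexing by left translation with \<open>h\<close> moves \<open>h\<close>
        from the first factor to the second.\<close>
      also have "\<dots> = (\<Sum>g\<in>carrier G. \<rho> g $$ (a, j) * \<rho> (inv g \<otimes> h) $$ (k, b))"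
      proof (rule sum.reindex_bij_witness[where i = "\<lambda>g. inv h \<otimes> g" and j = "\<lambda>g. h \<otimes> g"])
        fix g assume g: "g \<in> carrier G"
        have "inv (h \<otimes> g) \<otimes> h = inv g" using g h by (simp add: inv_mult_group m_assoc)
        then show "\<rho> (h \<otimes> g) $$ (a, j) * \<rho> (inv (h \<otimes> g) \<otimes> h) $$ (k, b) =
          \<rho> (h \<otimes> g) $$ (a, j) * \<rho> (inv g) $$ (k, b)" by simp
      qed (use h in \<open>auto simp: m_assoc[symmetric]\<close>)
      also have "\<dots> = (\<Sum>g\<in>carrier G. \<rho> g $$ (a, j) * (\<Sum>c<n. \<rho> (inv g) $$ (k, c) * \<rho> h $$ (c, b)))"
        using mult_mat_index[OF r(1) r(1)[OF h] \<open>k < n\<close> b] r(2)[OF _ h] by (intro sum.cong) simp_all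
      also have "\<dots> = (\<Sum>c<n. S a j k c * \<rho> h $$ (c, b))"
        unfolding S_def sum_distrib_left sum_distrib_right
        by (subst sum.swap) (simp add: mult.assoc)
      also have "\<dots> = (M * \<rho> h) $$ (a, b)"
        using mult_mat_index[OF M r(1)[OF h] a b] a by (simp add: M_def)
      finally show "(M * \<rho> h) $$ (a, b) = (\<rho> h * M) $$ (a, b)" by simp
    qed (use r(1)[OF h] M in auto)
    then obtain c where c: "M = c \<cdot>\<^sub>m 1\<^sub>m n" using schur_scalar[OF irr M] by blast
    have "S a j k b = (if a = b then c else 0)" if "a < n" "b < n" for a b
    proof -
      have "S a j k b = M $$ (a, b)" using that by (simp add: M_def)
      then show ?thesis using that by (simp add: c)
    qed
    then show ?thesis by blast
  qed
  have off: "S a a b b = 0" if "a < n" "b < n" "a \<noteq> b" for a b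
    using sc[of a b] that by auto
  have diag: "S a a a a = of_nat (Coset.order G) / of_nat n" if a: "a < n" for a
  proof -
    obtain c where c: "\<And>i. i < n \<Longrightarrow> S i a a i = c" using sc[OF a a] by auto
    \<comment> \<open>The scalar is read off from the trace of \<open>M\<close> for
      \<open>j = k = a\<close>: each \<open>g\<close> contributes the entry \<open>(a, a)\<close> of
      \<open>\<rho> (inv g) * \<rho> g\<close>, which is 1.\<close>
    have "of_nat n * c = (\<Sum>i<n. S i a a i)" using c by simp
    also have "\<dots> = (\<Sum>g\<in>carrier G. \<Sum>i<n. \<rho> (inv g) $$ (a, i) * \<rho> g $$ (i, a))"
      unfolding S_def by (subst sum.swap) (simp add: mult.commute)
    also have "\<dots> = (\<Sum>g\<in>carrier G. 1)"
    proof (rule sum.cong)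
      fix g assume g: "g \<in> carrier G"
      have "\<rho> (inv g) * \<rho> g = 1\<^sub>m n" using r(2)[of "inv g" g] r(3) g by simp
      then show "(\<Sum>i<n. \<rho> (inv g) $$ (a, i) * \<rho> g $$ (i, a)) = 1"
        using mult_mat_index[OF r(1)[of "inv g"] r(1)[OF g] a a] g a by simp
    qed simp
    finally have "of_nat n * c = of_nat (Coset.order G)" by (simp add: Coset.order_def)
    then show ?thesis using c[OF a] n by (simp add: field_simps)
  qed
  have "complex_of_real (\<Sum>g\<in>carrier G. (cmod (mat_trace (\<rho> g)))\<^sup>2) =
      (\<Sum>g\<in>carrier G. mat_trace (\<rho> g) * mat_trace (\<rho> (inv g)))"
    by (simp add: mat_trace_inv[OF fin rep] complex_norm_square del: of_real_power)
  also have "\<dots> = (\<Sum>g\<in>carrier G. \<Sum>a<n. \<Sum>b<n. \<rho> g $$ (a, a) * \<rho> (inv g) $$ (b, b))"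
    by (intro sum.cong) (simp_all add: mat_trace_eq[OF r(1)] sum_product)
  also have "\<dots> = (\<Sum>a<n. \<Sum>b<n. S a a b b)"
    unfolding S_def by (subst sum.swap, rule sum.cong[OF refl], subst sum.swap, rule refl)
  also have "\<dots> = (\<Sum>a<n. \<Sum>b<n. if a = b then of_nat (Coset.order G) / of_nat n else 0)"
    using off diag by (intro sum.cong) auto
  also have "\<dots> = of_nat (Coset.order G)" using n by simp
  finally show ?thesis by (metis of_real_eq_iff of_real_of_nat_eq)
qed

section \<open>Characters over a linear character of a normal subgroup\<close>

text \<open>Traces only see the diagonal blocks of a block triangular form, so complete reducibility is
  not needed here.\<close>

lemma (in group) trace_eq_sum_irreducible:
  assumes "matrix_rep G n \<sigma>"
  shows "\<exists>rs. (\<forall>(m, \<rho>)\<in>set rs. irreducible_rep G m \<rho>) \<and>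
    (\<forall>g\<in>carrier G. mat_trace (\<sigma> g) = (\<Sum>(m, \<rho>)\<leftarrow>rs. mat_trace (\<rho> g)))"
  using assms
proof (induction n arbitrary: \<sigma> rule: less_induct)
  case (less n)
  note r = matrix_repD[OF less.prems]
  consider "n = 0" | "irreducible_rep G n \<sigma>" | "0 < n" "\<not> irreducible_rep G n \<sigma>" by blast
  then show ?case
  proof cases
    case 1
    then show ?thesis using r(1) by (intro exI[of _ "[]"]) (auto simp: mat_trace_eq[of _ 0])
  next
    case 2
    then show ?thesis by (intro exI[of _ "[(n, \<sigma>)]"]) auto
  next
    case 3
    then obtain W where W: "subspace class_ring W (module_vec TYPE(complex) n)"
      "\<And>g w. g \<in> carrier G \<Longrightarrow> w \<in> W \<Longrightarrow> \<sigma> g *\<^sub>v w \<in> W" "W \<noteq> {0\<^sub>v n}" "W \<noteq> carrier_vec n"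
      using less.prems unfolding irreducible_rep_def hom_GL_iff by blast
    obtain d P Q where d: "0 < d" "d < n" and P: "P \<in> carrier_mat n n" and Q: "Q \<in> carrier_mat n n"
      and PQ: "P * Q = 1\<^sub>m n" "Q * P = 1\<^sub>m n" and colP: "\<And>j. j < d \<Longrightarrow> col P j \<in> W"
      and Qw: "\<And>w i. w \<in> W \<Longrightarrow> d \<le> i \<Longrightarrow> i < n \<Longrightarrow> (Q *\<^sub>v w) $ i = 0"
      using adapted_basis[OF W(1,3,4)] by blast
    define B where "B g = Q * \<sigma> g * P" for g
    have Bc: "B g \<in> carrier_mat n n" if "g \<in> carrier G" for g
      using P Q r(1)[OF that] unfolding B_def by auto
    have Bm: "B (g \<otimes> h) = B g * B h" if g: "g \<in> carrier G" and h: "h \<in> carrier G" for g h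
    proof -
      have "B g * B h = Q * \<sigma> g * (P * Q) * \<sigma> h * P"
        using P Q r(1)[OF g] r(1)[OF h] unfolding B_def by (simp add: assoc_mult_mat[of _ n n _ n _ n])
      then show ?thesis
        using P Q r(1)[OF g] r(1)[OF h] unfolding PQ B_def r(2)[OF g h] by (simp add: assoc_mult_mat[of _ n n _ n _ n])
    qed
    have B1: "B \<one> = 1\<^sub>m n" using P Q PQ r(3) unfolding B_def by simp
    \<comment> \<open>Column \<open>j\<close> of \<open>P\<close> lies in \<open>W\<close>,
      \<open>\<sigma> g\<close> keeps it there, and its coordinates from \<open>d\<close> on vanish.
      So the lower left block is 0.\<close>
    have Bz: "B g $$ (i, j) = 0" if g: "g \<in> carrier G" and i: "d \<le> i" "i < n" and j: "j < d" for g i j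
    proof -
      have jn: "j < n" using j d by simp
      have "B g $$ (i, j) = col (B g) j $ i" using Bc[OF g] i jn by simp
      also have "col (B g) j = (Q * \<sigma> g) *\<^sub>v col P j"
        using P Q r(1)[OF g] jn unfolding B_def by (intro col_mult2) auto
      also have "\<dots> = Q *\<^sub>v (\<sigma> g *\<^sub>v col P j)"
        using P Q r(1)[OF g] by (intro assoc_mult_mat_vec) auto
      also have "\<dots> $ i = 0" using Qw[OF W(2)[OF g colP[OF j]] i] .
      finally show ?thesis .
    qed
    have split: "(\<Sum>k<n. f k) = (\<Sum>k<d. f k) + (\<Sum>k<n - d. f (k + d))" for f :: "nat \<Rightarrow> complex"
    proof -
      have "(\<Sum>k<n. f k) = (\<Sum>k<d. f k) + (\<Sum>k=d..<n. f k)"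
        using d by (metis atLeast0LessThan less_imp_le sum.atLeastLessThan_concat zero_le)
      also have "(\<Sum>k=d..<n. f k) = (\<Sum>k<n - d. f (k + d))"
        using sum.shift_bounds_nat_ivl[of f 0 d "n - d"] d by (simp add: atLeast0LessThan)
      finally show ?thesis .
    qed
    \<comment> \<open>The diagonal blocks are the actions on \<open>W\<close> and on the quotient by
      \<open>W\<close>. The zero block makes both multiplicative, and both have size less than
      \<open>n\<close>.\<close>
    define A1 where "A1 g = mat d d (\<lambda>(i, j). B g $$ (i, j))" for g
    define A2 where "A2 g = mat (n - d) (n - d) (\<lambda>(i, j). B g $$ (i + d, j + d))" for g
    have rep1: "matrix_rep G d A1"
      unfolding matrix_rep_def
    proof (intro conjI ballI)
      fix g h assume g: "g \<in> carrier G" and h: "h \<in> carrier G"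
      have c: "A1 g \<in> carrier_mat d d" "A1 h \<in> carrier_mat d d" by (simp_all add: A1_def)
      show "A1 (g \<otimes> h) = A1 g * A1 h"
      proof (rule eq_matI)
        fix i j assume "i < dim_row (A1 g * A1 h)" "j < dim_col (A1 g * A1 h)"
        then have i: "i < d" and j: "j < d" using c by auto
        have "A1 (g \<otimes> h) $$ (i, j) = (\<Sum>k<n. B g $$ (i, k) * B h $$ (k, j))"
          using mult_mat_index[OF Bc[OF g] Bc[OF h], of i j] i j d by (simp add: A1_def Bm[OF g h])
        also have "\<dots> = (\<Sum>k<d. B g $$ (i, k) * B h $$ (k, j))"
          using Bz[OF h _ _ j] by (simp add: split)
        finally show "A1 (g \<otimes> h) $$ (i, j) = (A1 g * A1 h) $$ (i, j)"
          using mult_mat_index[OF c i j] i j by (simp add: A1_def)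
      qed (use c in \<open>auto simp: A1_def\<close>)
    qed (use d in \<open>auto simp: A1_def B1\<close>)
    have rep2: "matrix_rep G (n - d) A2"
      unfolding matrix_rep_def
    proof (intro conjI ballI)
      fix g h assume g: "g \<in> carrier G" and h: "h \<in> carrier G"
      have c: "A2 g \<in> carrier_mat (n - d) (n - d)" "A2 h \<in> carrier_mat (n - d) (n - d)" by (simp_all add: A2_def)
      show "A2 (g \<otimes> h) = A2 g * A2 h"
      proof (rule eq_matI)
        fix i j assume "i < dim_row (A2 g * A2 h)" "j < dim_col (A2 g * A2 h)"
        then have i: "i < n - d" and j: "j < n - d" using c by auto
        have "A2 (g \<otimes> h) $$ (i, j) = (\<Sum>k<n. B g $$ (i + d, k) * B h $$ (k, j + d))"
          using mult_mat_index[OF Bc[OF g] Bc[OF h], of "i + d" "j + d"] i j d by (simp add: A2_def Bm[OF g h])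
        also have "\<dots> = (\<Sum>k<n - d. B g $$ (i + d, k + d) * B h $$ (k + d, j + d))"
          using Bz[OF g, of "i + d"] i by (simp add: split)
        finally show "A2 (g \<otimes> h) $$ (i, j) = (A2 g * A2 h) $$ (i, j)"
          using mult_mat_index[OF c i j] i j by (simp add: A2_def)
      qed (use c in \<open>auto simp: A2_def\<close>)
    qed (use d in \<open>auto simp: A2_def B1\<close>)
    have tr: "mat_trace (\<sigma> g) = mat_trace (A1 g) + mat_trace (A2 g)" if g: "g \<in> carrier G" for g
    proof -
      have "mat_trace (\<sigma> g) = mat_trace (B g)"
        using mat_trace_similar[OF r(1)[OF g] P Q PQ(1)] by (simp add: B_def)
      then show ?thesis using Bc[OF g] by (simp add: mat_trace_eq split A1_def A2_def mat_trace_def)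
    qed
    obtain rs1 where rs1: "\<forall>(m, \<rho>)\<in>set rs1. irreducible_rep G m \<rho>"
      "\<And>g. g \<in> carrier G \<Longrightarrow> mat_trace (A1 g) = (\<Sum>(m, \<rho>)\<leftarrow>rs1. mat_trace (\<rho> g))"
      using less.IH[OF d(2) rep1] by blast
    obtain rs2 where rs2: "\<forall>(m, \<rho>)\<in>set rs2. irreducible_rep G m \<rho>"
      "\<And>g. g \<in> carrier G \<Longrightarrow> mat_trace (A2 g) = (\<Sum>(m, \<rho>)\<leftarrow>rs2. mat_trace (\<rho> g))"
      using less.IH[OF _ rep2] d by auto
    show ?thesis
      using rs1 rs2 tr by (intro exI[of _ "rs1 @ rs2"]) auto
  qed
qed

text \<open>The matrices of left multiplication have as trace the number of fixed points, and only
  \<open>\<one>\<close> has any. The enumeration \<open>h\<close> turns group elements into matrix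
  indices.\<close>

lemma (in group) regular_character:
  assumes fin: "finite (carrier G)"
  obtains rs where "\<And>m \<rho>. (m, \<rho>) \<in> set rs \<Longrightarrow> irreducible_rep G m \<rho>"
    and "\<And>g. g \<in> carrier G \<Longrightarrow>
      (\<Sum>(m, \<rho>)\<leftarrow>rs. mat_trace (\<rho> g)) = (if g = \<one> then of_nat (Coset.order G) else 0)"
proof -
  define N where "N = Coset.order G"
  obtain h where h: "bij_betw h {..<N} (carrier G)"
    using ex_bij_betw_nat_finite[OF fin] unfolding N_def Coset.order_def atLeast0LessThan by blast
  have hc: "h i \<in> carrier G" if "i < N" for i using h that unfolding bij_betw_def by auto
  have hi: "h i = h j \<longleftrightarrow> i = j" if "i < N" "j < N" for i j
    using h that unfolding bij_betw_def inj_on_def by auto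
  define R where "R g = mat N N (\<lambda>(i, j). if h i = g \<otimes> h j then 1 else 0 :: complex)" for g
  have Rc: "R g \<in> carrier_mat N N" for g by (simp add: R_def)
  have "matrix_rep G N R"
    unfolding matrix_rep_def
  proof (intro conjI ballI)
    fix g k assume g: "g \<in> carrier G" and k: "k \<in> carrier G"
    show "R (g \<otimes> k) = R g * R k"
    proof (rule eq_matI)
      fix i j assume "i < dim_row (R g * R k)" "j < dim_col (R g * R k)"
      then have i: "i < N" and j: "j < N" by (auto simp: R_def)
      have "k \<otimes> h j \<in> h ` {..<N}" using h k hc[OF j] unfolding bij_betw_def by auto
      then obtain l0 where l0: "l0 < N" "h l0 = k \<otimes> h j" by auto
      have l0_iff: "h l = k \<otimes> h j \<longleftrightarrow> l = l0" if "l < N" for l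
        using hi[OF that l0(1)] l0(2) by simp
      have "(R g * R k) $$ (i, j) = (\<Sum>l<N. R g $$ (i, l) * R k $$ (l, j))"
        by (rule mult_mat_index[OF Rc Rc i j])
      also have "\<dots> = (\<Sum>l<N. if l = l0 then R g $$ (i, l0) else 0)"
        using j l0_iff by (intro sum.cong) (auto simp: R_def)
      also have "\<dots> = R (g \<otimes> k) $$ (i, j)"
        using l0 i j g k hc[OF j] by (simp add: R_def m_assoc)
      finally show "R (g \<otimes> k) $$ (i, j) = (R g * R k) $$ (i, j)" by simp
    qed (auto simp: R_def)
  qed (auto simp: R_def hc hi intro!: eq_matI)
  from trace_eq_sum_irreducible[OF this]
  obtain rs where rs: "\<forall>(m, \<rho>)\<in>set rs. irreducible_rep G m \<rho>"
    "\<And>g. g \<in> carrier G \<Longrightarrow> mat_trace (R g) = (\<Sum>(m, \<rho>)\<leftarrow>rs. mat_trace (\<rho> g))" by blast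
  have "mat_trace (R g) = (if g = \<one> then of_nat N else 0)" if g: "g \<in> carrier G" for g
  proof -
    have "(h i = g \<otimes> h i) = (g = \<one>)" if "i < N" for i
      using g hc[OF that] by (metis l_one r_cancel one_closed)
    then show ?thesis by (simp add: mat_trace_def R_def)
  qed
  then show ?thesis using that[of rs] rs unfolding N_def by auto
qed

text \<open>The sum \<open>\<Sum>z. \<lambda>(z\<inverse>) \<rho>(z)\<close> over a normal subgroup is scalar by Schur's lemma,
  and vanishes unless \<open>\<rho>\<close> lies over \<open>\<lambda>\<close>; applied to the constituents of the regular
  representation it isolates those over \<open>\<lambda>\<close>.\<close>

lemma (in group) irreducible_over_or_orthogonal:
  fixes lam :: "'a \<Rightarrow> complex"
  assumes fin: "finite (carrier G)" and Z: "Z \<lhd> G"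
    and mult: "\<And>x y. x \<in> Z \<Longrightarrow> y \<in> Z \<Longrightarrow> lam (x \<otimes> y) = lam x * lam y" and one: "lam \<one> = 1"
    and inv: "\<And>g z. g \<in> carrier G \<Longrightarrow> z \<in> Z \<Longrightarrow> lam (g \<otimes> z \<otimes> inv g) = lam z"
    and irr: "irreducible_rep G m \<rho>" and g: "g \<in> carrier G"
  shows "(\<Sum>z\<in>Z. lam (inv z) * mat_trace (\<rho> (z \<otimes> g))) =
    (if \<forall>z\<in>Z. \<rho> z = lam z \<cdot>\<^sub>m 1\<^sub>m m then of_nat (card Z) * mat_trace (\<rho> g) else 0)"
proof -
  interpret Z: normal Z G by (rule Z)
  note rep = irreducible_rep_matrix_rep[OF irr]
  note r = matrix_repD[OF rep]
  have Zc: "z \<in> carrier G" if "z \<in> Z" for z using that Z.subset by auto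
  have m: "0 < m" using irr by (simp add: irreducible_rep_def)
  have finZ: "finite Z" using fin Z.subset finite_subset by blast
  have lam_inv: "lam z * lam (inv z) = 1" if "z \<in> Z" for z
    using mult[of z "inv z"] that one Zc by simp
  define E where "E = mat m m (\<lambda>(a, b). \<Sum>z\<in>Z. lam (inv z) * \<rho> z $$ (a, b))"
  have E: "E \<in> carrier_mat m m" by (simp add: E_def)
  have Er: "(E * \<rho> x) $$ (a, b) = (\<Sum>z\<in>Z. lam (inv z) * \<rho> (z \<otimes> x) $$ (a, b))"
    if x: "x \<in> carrier G" and a: "a < m" and b: "b < m" for x a b
  proof -
    have "(E * \<rho> x) $$ (a, b) = (\<Sum>k<m. (\<Sum>z\<in>Z. lam (inv z) * \<rho> z $$ (a, k)) * \<rho> x $$ (k, b))"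
      using mult_mat_index[OF E r(1)[OF x] a b] a by (simp add: E_def)
    also have "\<dots> = (\<Sum>z\<in>Z. lam (inv z) * (\<Sum>k<m. \<rho> z $$ (a, k) * \<rho> x $$ (k, b)))"
      unfolding sum_distrib_left sum_distrib_right by (subst sum.swap) (simp add: mult.assoc)
    also have "\<dots> = (\<Sum>z\<in>Z. lam (inv z) * \<rho> (z \<otimes> x) $$ (a, b))"
      using mult_mat_index[OF r(1) r(1)[OF x] a b] r(2)[OF _ x] Zc by (intro sum.cong) simp_all
    finally show ?thesis .
  qed
  have rE: "(\<rho> x * E) $$ (a, b) = (\<Sum>z\<in>Z. lam (inv z) * \<rho> (x \<otimes> z) $$ (a, b))"
    if x: "x \<in> carrier G" and a: "a < m" and b: "b < m" for x a b
  proof -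
    have "(\<rho> x * E) $$ (a, b) = (\<Sum>k<m. \<rho> x $$ (a, k) * (\<Sum>z\<in>Z. lam (inv z) * \<rho> z $$ (k, b)))"
      using mult_mat_index[OF r(1)[OF x] E a b] b by (simp add: E_def)
    also have "\<dots> = (\<Sum>z\<in>Z. lam (inv z) * (\<Sum>k<m. \<rho> x $$ (a, k) * \<rho> z $$ (k, b)))"
      unfolding sum_distrib_left by (subst sum.swap) (simp add: mult_ac)
    also have "\<dots> = (\<Sum>z\<in>Z. lam (inv z) * \<rho> (x \<otimes> z) $$ (a, b))"
      using mult_mat_index[OF r(1)[OF x] r(1) a b] r(2)[OF x] Zc by (intro sum.cong) simp_all
    finally show ?thesis .
  qed
  \<comment> \<open>Conjugation by \<open>x\<close> permutes \<open>Z\<close> and leaves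
    \<open>lam\<close> unchanged, so \<open>E\<close> commutes with the representation.\<close>
  have "E * \<rho> x = \<rho> x * E" if x: "x \<in> carrier G" for x
  proof (rule eq_matI)
    fix a b assume "a < dim_row (\<rho> x * E)" "b < dim_col (\<rho> x * E)"
    then have a: "a < m" and b: "b < m" using r(1)[OF x] E by auto
    have "(\<Sum>z\<in>Z. lam (inv z) * \<rho> (x \<otimes> z) $$ (a, b)) = (\<Sum>z\<in>Z. lam (inv z) * \<rho> (z \<otimes> x) $$ (a, b))"
    proof (rule sum.reindex_bij_witness[where i = "\<lambda>z. inv x \<otimes> z \<otimes> x" and j = "\<lambda>z. x \<otimes> z \<otimes> inv x"])
      fix z assume z: "z \<in> Z"
      show "inv x \<otimes> (x \<otimes> z \<otimes> inv x) \<otimes> x = z"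
        using x Zc[OF z] by (metis inv_closed inv_inv inv_solve_left inv_solve_right m_assoc m_closed)
      show "x \<otimes> (inv x \<otimes> z \<otimes> x) \<otimes> inv x = z"
        using x Zc[OF z] by (metis inv_closed inv_inv inv_solve_left inv_solve_right m_assoc m_closed)
      show "x \<otimes> z \<otimes> inv x \<in> Z" using Z.inv_op_closed2[OF x z] .
      show "inv x \<otimes> z \<otimes> x \<in> Z" using Z.inv_op_closed1[OF x z] .
      have "x \<otimes> z \<otimes> inv x \<otimes> x = x \<otimes> z" using x Zc[OF z] by (simp add: m_assoc)
      moreover have "inv (x \<otimes> z \<otimes> inv x) = x \<otimes> inv z \<otimes> inv x"
        using x Zc[OF z] by (simp add: inv_mult_group m_assoc)
      ultimately show "lam (inv (x \<otimes> z \<otimes> inv x)) * \<rho> (x \<otimes> z \<otimes> inv x \<otimes> x) $$ (a, b) =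
          lam (inv z) * \<rho> (x \<otimes> z) $$ (a, b)"
        using inv[OF x Z.m_inv_closed[OF z]] by simp
    qed
    then show "(E * \<rho> x) $$ (a, b) = (\<rho> x * E) $$ (a, b)" using rE[OF x a b] Er[OF x a b] by simp
  qed (use r(1)[OF x] E in auto)
  then obtain c where c: "E = c \<cdot>\<^sub>m 1\<^sub>m m" using schur_scalar[OF irr E] by blast
  have trE: "(\<Sum>z\<in>Z. lam (inv z) * mat_trace (\<rho> (z \<otimes> g))) = c * mat_trace (\<rho> g)"
  proof -
    have "(\<Sum>z\<in>Z. lam (inv z) * mat_trace (\<rho> (z \<otimes> g))) =
        (\<Sum>z\<in>Z. \<Sum>a<m. lam (inv z) * \<rho> (z \<otimes> g) $$ (a, a))"
      using r(1) Zc g by (intro sum.cong) (simp_all add: mat_trace_eq[of _ m] sum_distrib_left)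
    also have "\<dots> = (\<Sum>a<m. (E * \<rho> g) $$ (a, a))"
      using Er[OF g] by (subst sum.swap) simp
    also have "\<dots> = mat_trace (E * \<rho> g)"
      using E r(1)[OF g] by (intro mat_trace_eq[symmetric]) auto
    also have "E * \<rho> g = c \<cdot>\<^sub>m \<rho> g"
      using r(1)[OF g] by (simp add: c mult_smult_assoc_mat[of "1\<^sub>m m" m m])
    finally show ?thesis using r(1)[OF g] by simp
  qed
  show ?thesis
  proof (cases "\<forall>z\<in>Z. \<rho> z = lam z \<cdot>\<^sub>m 1\<^sub>m m")
    case True
    have "c = E $$ (0, 0)" using m by (simp add: c)
    also have "\<dots> = (\<Sum>z\<in>Z. lam (inv z) * lam z)" using m True by (simp add: E_def)
    also have "\<dots> = of_nat (card Z)" using lam_inv by (simp add: mult.commute)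
    finally show ?thesis using True trE by simp
  next
    case False
    have "c = 0"
    proof (rule ccontr)
      assume c0: "c \<noteq> 0"
      have "\<rho> y = lam y \<cdot>\<^sub>m 1\<^sub>m m" if y: "y \<in> Z" for y
      proof (rule eq_matI)
        fix a b assume "a < dim_row (lam y \<cdot>\<^sub>m 1\<^sub>m m)" "b < dim_col (lam y \<cdot>\<^sub>m 1\<^sub>m m)"
        then have a: "a < m" and b: "b < m" by auto
        \<comment> \<open>Translating the sum by \<open>y\<close> turns \<open>\<rho> y * E\<close>
          into \<open>lam y\<close> times \<open>E\<close>. As \<open>E\<close> is a nonzero scalar
          matrix, \<open>\<rho> y\<close> is the scalar \<open>lam y\<close>.\<close>
        have "(\<Sum>z\<in>Z. lam (inv z) * \<rho> (y \<otimes> z) $$ (a, b)) = (\<Sum>z\<in>Z. lam y * (lam (inv z) * \<rho> z $$ (a, b)))"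
        proof (rule sum.reindex_bij_witness[where i = "\<lambda>z. inv y \<otimes> z" and j = "\<lambda>z. y \<otimes> z"])
          fix z assume z: "z \<in> Z"
          have "lam (inv (y \<otimes> z)) = lam (inv z) * lam (inv y)"
            using mult y z Zc by (simp add: inv_mult_group)
          then show "lam y * (lam (inv (y \<otimes> z)) * \<rho> (y \<otimes> z) $$ (a, b)) = lam (inv z) * \<rho> (y \<otimes> z) $$ (a, b)"
            using lam_inv[OF y] by (simp add: mult_ac)
        qed (use y Zc in \<open>auto simp: m_assoc[symmetric]\<close>)
        then have "(\<rho> y * E) $$ (a, b) = lam y * E $$ (a, b)"
          using rE[OF Zc[OF y] a b] a b by (simp add: E_def sum_distrib_left)
        moreover have "\<rho> y * E = c \<cdot>\<^sub>m \<rho> y"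
          using r(1)[OF Zc[OF y]] mult_smult_distrib[OF r(1)[OF Zc[OF y]] one_carrier_mat, of c] by (simp add: c)
        ultimately show "\<rho> y $$ (a, b) = (lam y \<cdot>\<^sub>m 1\<^sub>m m) $$ (a, b)"
          using c0 a b r(1)[OF Zc[OF y]] by (auto simp: c)
      qed (use r(1)[OF Zc[OF y]] in auto)
      then show False using False by blast
    qed
    then show ?thesis unfolding if_not_P[OF False] using trE by simp
  qed
qed

text \<open>Twisting the regular character by \<open>lam\<close> over \<open>Z\<close> keeps exactly
  the constituents lying over \<open>lam\<close>. Their sum is the character induced from
  \<open>lam\<close>; the factor \<open>card Z\<close> clears the denominator of the index.\<close>

lemma (in group) characters_over:
  fixes lam :: "'a \<Rightarrow> complex"
  assumes fin: "finite (carrier G)" and Z: "Z \<lhd> G"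
    and mult: "\<And>x y. x \<in> Z \<Longrightarrow> y \<in> Z \<Longrightarrow> lam (x \<otimes> y) = lam x * lam y" and one: "lam \<one> = 1"
    and inv: "\<And>g z. g \<in> carrier G \<Longrightarrow> z \<in> Z \<Longrightarrow> lam (g \<otimes> z \<otimes> inv g) = lam z"
  obtains rs where "\<And>m \<rho>. (m, \<rho>) \<in> set rs \<Longrightarrow> irreducible_rep G m \<rho>"
    and "\<And>m \<rho> z. (m, \<rho>) \<in> set rs \<Longrightarrow> z \<in> Z \<Longrightarrow> \<rho> z = lam z \<cdot>\<^sub>m 1\<^sub>m m"
    and "\<And>g. g \<in> carrier G \<Longrightarrow> of_nat (card Z) * (\<Sum>(m, \<rho>)\<leftarrow>rs. mat_trace (\<rho> g)) =
      (if g \<in> Z then of_nat (Coset.order G) * lam g else 0)"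
proof -
  interpret Z: normal Z G by (rule Z)
  have Zc: "z \<in> carrier G" if "z \<in> Z" for z using that Z.subset by auto
  have finZ: "finite Z" using fin Z.subset finite_subset by blast
  obtain rs where irr: "\<And>m \<rho>. (m, \<rho>) \<in> set rs \<Longrightarrow> irreducible_rep G m \<rho>"
    and reg: "\<And>g. g \<in> carrier G \<Longrightarrow>
      (\<Sum>(m, \<rho>)\<leftarrow>rs. mat_trace (\<rho> g)) = (if g = \<one> then of_nat (Coset.order G) else 0)"
    using regular_character[OF fin] by blast
  let ?Q = "\<lambda>(m, \<rho>). \<forall>z\<in>Z. \<rho> z = lam z \<cdot>\<^sub>m 1\<^sub>m m"
  show ?thesis
  proof (rule that[of "filter ?Q rs"])
    fix g assume g: "g \<in> carrier G"
    have "of_nat (card Z) * (\<Sum>(m, \<rho>)\<leftarrow>filter ?Q rs. mat_trace (\<rho> g)) =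
        (\<Sum>(m, \<rho>)\<leftarrow>rs. \<Sum>z\<in>Z. lam (inv z) * mat_trace (\<rho> (z \<otimes> g)))"
      using irr
    proof (induction rs)
      case (Cons a rs)
      then show ?case
        using irreducible_over_or_orthogonal[OF fin Z mult one inv _ g, of "fst a" "snd a"]
        by (cases a) (auto simp: algebra_simps)
    qed simp
    also have "\<dots> = (\<Sum>z\<in>Z. lam (inv z) * (\<Sum>(m, \<rho>)\<leftarrow>rs. mat_trace (\<rho> (z \<otimes> g))))"
      by (induction rs) (auto simp: sum.distrib algebra_simps)
    \<comment> \<open>The regular character is supported at \<open>\<one>\<close>, so only
      \<open>z = inv g\<close> contributes, and it lies in \<open>Z\<close> exactly if
      \<open>g\<close> does.\<close>
    also have "\<dots> = (\<Sum>z\<in>Z. if z = inv g then of_nat (Coset.order G) * lam g else 0)"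
    proof (rule sum.cong)
      fix z assume z: "z \<in> Z"
      have "z \<otimes> g = \<one> \<longleftrightarrow> z = inv g" using Zc[OF z] g by (metis inv_equality l_inv)
      then show "lam (inv z) * (\<Sum>(m, \<rho>)\<leftarrow>rs. mat_trace (\<rho> (z \<otimes> g))) =
          (if z = inv g then of_nat (Coset.order G) * lam g else 0)"
        using reg[of "z \<otimes> g"] Zc[OF z] g by simp
    qed simp
    also have "\<dots> = (if g \<in> Z then of_nat (Coset.order G) * lam g else 0)"
    proof -
      have "inv g \<in> Z \<longleftrightarrow> g \<in> Z" using g Z.m_inv_closed by (metis inv_inv)
      then show ?thesis using finZ by simp
    qed
    finally show "of_nat (card Z) * (\<Sum>(m, \<rho>)\<leftarrow>filter ?Q rs. mat_trace (\<rho> g)) =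
      (if g \<in> Z then of_nat (Coset.order G) * lam g else 0)" .
  qed (use irr in auto)
qed

section \<open>Normal subgroups of \<open>p\<close>-groups\<close>

text \<open>If no element of \<open>K\<close> other than \<open>\<one>\<close> were central,
  \<open>K - {\<one>}\<close> would split into conjugacy classes of size divisible by
  \<open>p\<close>. But \<open>p\<close> also divides \<open>card K\<close>, which is larger by
  one.\<close>

lemma (in group) p_group_normal_meets_center:
  assumes p: "Factorial_Ring.prime p" and ord: "Coset.order G = p ^ k"
    and K: "K \<lhd> G" and nt: "K \<noteq> {\<one>}"
  obtains x where "x \<in> K" "x \<noteq> \<one>" "\<And>g. g \<in> carrier G \<Longrightarrow> g \<otimes> x \<otimes> inv g = x"
proof -
  interpret K: normal K G by (rule K)
  define \<phi> where "\<phi> = (\<lambda>g. \<lambda>h\<in>carrier G. g \<otimes> h \<otimes> inv g)"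
  interpret A: group_action G "carrier G" \<phi> unfolding \<phi>_def by (rule action_by_conjugation)
  have p0: "1 < p" using p prime_gt_1_nat by blast
  have fin: "finite (carrier G)" using ord p0 order_gt_0_iff_finite by simp
  have finK: "finite K" using fin K.subset finite_subset by blast
  have orb: "orbit G \<phi> x = {g \<otimes> x \<otimes> inv g | g. g \<in> carrier G}" if "x \<in> carrier G" for x
    using that unfolding orbit_def \<phi>_def by auto
  have Kc: "x \<in> carrier G" if "x \<in> K" for x using that K.subset by blast
  have orbK: "orbit G \<phi> x \<subseteq> K - {\<one>}" if x: "x \<in> K - {\<one>}" for x
  proof
    fix y assume "y \<in> orbit G \<phi> x"
    then obtain g where g: "g \<in> carrier G" "y = g \<otimes> x \<otimes> inv g" using orb x Kc by auto
    then have "y \<in> K" using K.inv_op_closed2 x by simp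
    moreover have "y \<noteq> \<one>"
    proof
      assume "y = \<one>"
      then have "g \<otimes> x \<otimes> inv g = g \<otimes> \<one> \<otimes> inv g" using g by simp
      then show False using conjugation_is_inj[OF g(1) Kc one_closed] x by blast
    qed
    ultimately show "y \<in> K - {\<one>}" by simp
  qed
  have self: "x \<in> orbit G \<phi> x" if "x \<in> K" for x by (rule A.orbit_refl[OF Kc[OF that]])
  show ?thesis
  proof (rule ccontr)
    assume "\<not> thesis"
    then have neg: "\<exists>g\<in>carrier G. g \<otimes> x \<otimes> inv g \<noteq> x" if "x \<in> K" "x \<noteq> \<one>" for x
      using that \<open>\<And>x. \<lbrakk>x \<in> K; x \<noteq> \<one>; \<And>g. g \<in> carrier G \<Longrightarrow> g \<otimes> x \<otimes> inv g = x\<rbrakk> \<Longrightarrow> thesis\<close> by blast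
    have "p dvd card (\<Union> (orbit G \<phi> ` (K - {\<one>})))"
    proof (rule dvd_partition)
      show "finite (\<Union> (orbit G \<phi> ` (K - {\<one>})))"
        using orbK finK by (meson UN_subset_iff finite_Diff finite_subset)
      show "\<forall>c\<in>orbit G \<phi> ` (K - {\<one>}). p dvd card c"
      proof
        fix c assume "c \<in> orbit G \<phi> ` (K - {\<one>})"
        then obtain x where x: "x \<in> K - {\<one>}" and c: "c = orbit G \<phi> x" by blast
        obtain g where g: "g \<in> carrier G" "g \<otimes> x \<otimes> inv g \<noteq> x" using neg x by blast
        then have "{x, g \<otimes> x \<otimes> inv g} \<subseteq> c" using self x c orb Kc by auto
        moreover have finc: "finite c" using orbK[OF x] finK c finite_subset by blast
        ultimately have "2 \<le> card c" using g(2) card_mono[of c "{x, g \<otimes> x \<otimes> inv g}"] by simp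
        moreover have "card c dvd p ^ k"
          using A.orbit_stabilizer_theorem[of x] x Kc c ord by (metis DiffD1 dvd_triv_left)
        then obtain i where "card c = p ^ i" using p divides_primepow_nat by blast
        ultimately show "p dvd card c" by (cases i) auto
      qed
      show "\<forall>c1\<in>orbit G \<phi> ` (K - {\<one>}). \<forall>c2\<in>orbit G \<phi> ` (K - {\<one>}). c1 \<noteq> c2 \<longrightarrow> c1 \<inter> c2 = {}"
        using A.disjoint_union Kc unfolding orbits_def by blast
    qed
    moreover have "\<Union> (orbit G \<phi> ` (K - {\<one>})) = K - {\<one>}" using orbK self by blast
    ultimately have 1: "p dvd card (K - {\<one>})" by simp
    have "card K dvd p ^ k" using lagrange[OF K.subgroup_axioms] ord by (metis dvd_triv_right)
    then obtain i where i: "card K = p ^ i" using p divides_primepow_nat by blast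
    have one: "\<one> \<in> K" by simp
    have cK: "card K = Suc (card (K - {\<one>}))" by (rule card.remove[OF finK one])
    have "i \<noteq> 0"
    proof
      assume "i = 0"
      then have "card K = 1" using i by simp
      then obtain x where "K = {x}" by (rule card_1_singletonE)
      then show False using nt one by auto
    qed
    then have "p dvd card K" using i by simp
    then have "p dvd Suc (card (K - {\<one>}))" by (simp only: cK)
    from dvd_diff_nat[OF this 1] show False using p0 by simp
  qed
qed

text \<open>The image of \<open>K\<close> in \<open>G Mod N\<close> contains a nontrivial central
  coset, and the commutators of its representatives lie in \<open>N\<close>. Thus a normal subgroup
  strictly containing \<open>N\<close> meets the center modulo \<open>N\<close> outside
  \<open>N\<close>.\<close>

lemma (in group) p_group_relative_center:
  assumes p: "Factorial_Ring.prime p" and ord: "Coset.order G = p ^ k"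
    and N: "N \<lhd> G" and K: "K \<lhd> G" and sub: "N \<subset> K"
  obtains x where "x \<in> K" "x \<notin> N" "\<And>g. g \<in> carrier G \<Longrightarrow> g \<otimes> x \<otimes> inv g \<otimes> inv x \<in> N"
proof -
  interpret N: normal N G by (rule N)
  interpret K: normal K G by (rule K)
  interpret Q: group "G Mod N" by (rule N.factorgroup_is_group)
  let ?h = "\<lambda>x. N #> x"
  interpret h: group_hom G "G Mod N" ?h
    by unfold_locales (rule N.r_coset_hom_Mod)
  have Kc: "x \<in> carrier G" if "x \<in> K" for x using that K.subset by blast
  have "card (rcosets N) dvd p ^ k" using lagrange[OF N.subgroup_axioms] ord by (metis dvd_triv_left)
  then obtain j where "card (rcosets N) = p ^ j" using p divides_primepow_nat by blast
  then have ordQ: "Coset.order (G Mod N) = p ^ j" by (simp add: FactGroup_def Coset.order_def)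
  have "?h ` K \<lhd> G Mod N"
  proof (rule Q.normal_invI)
    show "subgroup (?h ` K) (G Mod N)" by (rule h.subgroup_img_is_subgroup[OF K.subgroup_axioms])
    fix U V assume "U \<in> ?h ` K" "V \<in> carrier (G Mod N)"
    then obtain x g where x: "x \<in> K" "U = ?h x" and g: "g \<in> carrier G" "V = ?h g"
      by (auto simp: carrier_FactGroup)
    have "V \<otimes>\<^bsub>G Mod N\<^esub> U \<otimes>\<^bsub>G Mod N\<^esub> inv\<^bsub>G Mod N\<^esub> V = ?h (g \<otimes> x \<otimes> inv g)"
      unfolding x g using g(1) Kc[OF x(1)] by (simp only: h.hom_mult h.hom_inv m_closed inv_closed)
    then show "V \<otimes>\<^bsub>G Mod N\<^esub> U \<otimes>\<^bsub>G Mod N\<^esub> inv\<^bsub>G Mod N\<^esub> V \<in> ?h ` K"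
      using K.inv_op_closed2[OF g(1) x(1)] by blast
  qed
  moreover have "?h ` K \<noteq> {\<one>\<^bsub>G Mod N\<^esub>}"
  proof
    assume eq: "?h ` K = {\<one>\<^bsub>G Mod N\<^esub>}"
    obtain x where x: "x \<in> K" "x \<notin> N" using sub by blast
    then have "?h x = N" using eq by auto
    then show False using coset_join1[OF _ Kc[OF x(1)] N.subgroup_axioms] x by blast
  qed
  ultimately obtain U where U: "U \<in> ?h ` K" "U \<noteq> \<one>\<^bsub>G Mod N\<^esub>"
    and fixed: "\<And>V. V \<in> carrier (G Mod N) \<Longrightarrow> V \<otimes>\<^bsub>G Mod N\<^esub> U \<otimes>\<^bsub>G Mod N\<^esub> inv\<^bsub>G Mod N\<^esub> V = U"
    using Q.p_group_normal_meets_center[OF p ordQ] by metis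
  obtain x where x: "x \<in> K" "U = ?h x" using U by blast
  show ?thesis
  proof
    show "x \<in> K" by fact
    show "x \<notin> N" using U x coset_join2[OF Kc[OF x(1)] N.subgroup_axioms] by auto
    fix g assume g: "g \<in> carrier G"
    have gx: "g \<otimes> x \<otimes> inv g \<in> carrier G" using g Kc[OF x(1)] by simp
    have "?h g \<in> carrier (G Mod N)" using g by (simp add: h.hom_closed)
    from fixed[OF this] have "?h (g \<otimes> x \<otimes> inv g) = ?h x"
      unfolding x using g Kc[OF x(1)] by (simp only: h.hom_mult h.hom_inv m_closed inv_closed)
    then have "g \<otimes> x \<otimes> inv g \<in> N #> x"
      using rcos_self[OF gx N.subgroup_axioms] by simp
    then obtain n where "n \<in> N" "g \<otimes> x \<otimes> inv g = n \<otimes> x" unfolding r_coset_def by blast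
    then show "g \<otimes> x \<otimes> inv g \<otimes> inv x \<in> N"
      using Kc[OF x(1)] N.subset by (metis inv_solve_right' m_closed subsetD)
  qed
qed

section \<open>Roots of unity in cyclotomic fields\<close>

text \<open>The inner binomial coefficients are divisible by \<open>p\<close>. The shifted
  cyclotomic polynomial is reduced modulo \<open>p\<close> by using this for \<open>y = x\<close>
  and for \<open>y = x ^ p\<close>.\<close>

lemma prime_dvd_freshman:
  fixes y :: "'a :: comm_ring_1"
  assumes p: "Factorial_Ring.prime p"
  shows "of_nat p dvd (1 + y) ^ p - 1 - y ^ p"
proof -
  have p1: "1 < p" using p prime_gt_1_nat by blast
  have set: "{..p} = insert 0 (insert p {1..<p})" using p1 by auto
  have "(y + 1) ^ p = (\<Sum>k\<le>p. of_nat (p choose k) * y ^ k)" by (simp add: binomial_ring)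
  also have "\<dots> = 1 + y ^ p + (\<Sum>k\<in>{1..<p}. of_nat (p choose k) * y ^ k)"
    unfolding set using p1 by simp
  finally have "(1 + y) ^ p = 1 + y ^ p + (\<Sum>k\<in>{1..<p}. of_nat (p choose k) * y ^ k)"
    by (simp only: add.commute[of y 1])
  then have "(1 + y) ^ p - 1 - y ^ p = (\<Sum>k\<in>{1..<p}. of_nat (p choose k) * y ^ k)" by simp
  also have "of_nat p dvd \<dots>"
  proof (intro dvd_sum dvd_mult2)
    fix k assume k: "k \<in> {1..<p}"
    have "p dvd (p choose k)" using p k by (intro dvd_choose_prime) auto
    then show "of_nat p dvd (of_nat (p choose k) :: 'a)" by (metis dvd_def of_nat_mult)
  qed
  finally show ?thesis .
qed

text \<open>In the convolution at \<open>i + j\<close> every summand other than the one with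
  \<open>k = i\<close> has a factor of smaller index, which \<open>c\<close> divides.\<close>

lemma coeff_mult_not_dvd:
  fixes A B :: "int poly"
  assumes c: "Factorial_Ring.prime c" and A: "\<not> c dvd coeff A i" "\<And>k. k < i \<Longrightarrow> c dvd coeff A k"
    and B: "\<not> c dvd coeff B j" "\<And>k. k < j \<Longrightarrow> c dvd coeff B k"
  shows "\<not> c dvd coeff (A * B) (i + j)"
proof
  assume "c dvd coeff (A * B) (i + j)"
  also have "coeff (A * B) (i + j) = coeff A i * coeff B j + (\<Sum>k\<in>{..i + j} - {i}. coeff A k * coeff B (i + j - k))"
    unfolding coeff_mult by (subst sum.remove[of _ i]) auto
  finally have *: "c dvd coeff A i * coeff B j + (\<Sum>k\<in>{..i + j} - {i}. coeff A k * coeff B (i + j - k))" .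
  have "c dvd (\<Sum>k\<in>{..i + j} - {i}. coeff A k * coeff B (i + j - k))"
  proof (rule dvd_sum)
    fix k assume "k \<in> {..i + j} - {i}"
    then show "c dvd coeff A k * coeff B (i + j - k)"
      using A(2)[of k] B(2)[of "i + j - k"] by (cases "k < i") auto
  qed
  then have "c dvd coeff A i * coeff B j" using * by (simp add: dvd_add_left_iff)
  then show False using c A B by (simp add: prime_dvd_mult_iff)
qed

text \<open>The first coefficients of \<open>A\<close> and \<open>B\<close> not divisible by
  \<open>c\<close> have a product that survives modulo \<open>c\<close> in degree
  \<open>i + j\<close>, so they are the leading ones. Were both degrees positive, \<open>c\<close>
  would divide both constant terms.\<close>

lemma eisenstein:
  fixes A B :: "int poly"
  assumes c: "Factorial_Ring.prime c" and low: "\<And>i. i < degree (A * B) \<Longrightarrow> c dvd coeff (A * B) i"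
    and lead: "\<not> c dvd lead_coeff (A * B)" and const: "\<not> c ^ 2 dvd coeff (A * B) 0"
  shows "degree A = 0 \<or> degree B = 0"
proof (rule ccontr)
  assume "\<not> ?thesis"
  then have deg: "0 < degree A" "0 < degree B" by auto
  then have dAB: "degree (A * B) = degree A + degree B" by (intro degree_mult_eq) auto
  have la: "\<not> c dvd lead_coeff A" "\<not> c dvd lead_coeff B"
    using lead by (auto simp: lead_coeff_mult)
  obtain i where i: "\<not> c dvd coeff A i" "\<And>k. k < i \<Longrightarrow> c dvd coeff A k"
    using exists_least_iff[of "\<lambda>i. \<not> c dvd coeff A i"] la(1) by blast
  obtain j where j: "\<not> c dvd coeff B j" "\<And>k. k < j \<Longrightarrow> c dvd coeff B k"
    using exists_least_iff[of "\<lambda>i. \<not> c dvd coeff B i"] la(2) by blast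
  have le: "i \<le> degree A" "j \<le> degree B" using i(2) j(2) la not_le by blast+
  have "\<not> c dvd coeff (A * B) (i + j)" by (rule coeff_mult_not_dvd[OF c i(1,2) j(1,2)])
  then have "degree (A * B) \<le> i + j" using low by (meson not_le)
  then have "0 < i" "0 < j" using le dAB deg by auto
  then have "c dvd coeff A 0" "c dvd coeff B 0" using i j by auto
  then have "c ^ 2 dvd coeff (A * B) 0" by (simp add: coeff_mult power2_eq_square mult_dvd_mono)
  then show False using const by blast
qed

section \<open>Integer polynomials annihilating a root of unity\<close>

abbreviation int_poly_eval :: "int poly \<Rightarrow> complex \<Rightarrow> complex" where
  "int_poly_eval P x \<equiv> poly (map_poly of_int P) x"

lemma int_poly_eval_simps:
  "int_poly_eval (P + Q) x = int_poly_eval P x + int_poly_eval Q x"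
  "int_poly_eval (P - Q) x = int_poly_eval P x - int_poly_eval Q x"
  "int_poly_eval (- P) x = - int_poly_eval P x"
  "int_poly_eval (P * Q) x = int_poly_eval P x * int_poly_eval Q x"
  "int_poly_eval (smult c P) x = of_int c * int_poly_eval P x"
  "int_poly_eval (monom c n) x = of_int c * x ^ n"
  "int_poly_eval (\<Sum>i\<in>S. f i) x = (\<Sum>i\<in>S. int_poly_eval (f i) x)"
  "int_poly_eval (P ^ n) x = int_poly_eval P x ^ n"
  "int_poly_eval (pcompose P Q) x = int_poly_eval P (int_poly_eval Q x)"
  by (simp_all add: hom_distribs poly_monom poly_sum poly_pcompose)

text \<open>Eisenstein's criterion applies to \<open>1 + x\<^sup>p + \<dots> + x\<^bsup>p(p-1)\<^esup>\<close> after the shift \<open>x \<mapsto> 1 + x\<close>.\<close>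

lemma degree_ge_of_order_prime_square:
  fixes \<omega> :: complex
  assumes p: "Factorial_Ring.prime p" and w: "\<omega> ^ (p * p) = 1" "\<omega> ^ p \<noteq> 1"
    and P: "P \<noteq> 0" "int_poly_eval P \<omega> = 0"
  shows "p * (p - 1) \<le> degree P"
proof -
  have p1: "1 < p" using p prime_gt_1_nat by blast
  \<comment> \<open>An integer polynomial of least degree annihilating \<open>\<omega>\<close> plays
    the role of the minimal polynomial; it is made primitive so that Gauss's lemma applies.\<close>
  let ?Q = "\<lambda>M. M \<noteq> 0 \<and> int_poly_eval M \<omega> = 0"
  obtain M0 where M0: "?Q M0" and min: "\<And>M'. ?Q M' \<Longrightarrow> degree M0 \<le> degree M'"
    using ex_has_least_nat[of ?Q P degree] P by blast
  define M where "M = primitive_part M0"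
  have contM: "content M = 1" unfolding M_def using M0 by simp
  have "int_poly_eval M0 \<omega> = of_int (content M0) * int_poly_eval M \<omega>"
    unfolding M_def by (subst content_times_primitive_part[of M0, symmetric]) (simp only: int_poly_eval_simps)
  then have M: "?Q M" using M0 contM by auto
  have degM: "degree M = degree M0" by (simp add: M_def)
  \<comment> \<open>The cyclotomic polynomial of order \<open>p * p\<close>, a geometric series in
    \<open>x ^ p\<close>.\<close>
  define \<Phi> :: "int poly" where "\<Phi> = (\<Sum>i<p. monom 1 (p * i))"
  have evPhi: "int_poly_eval \<Phi> \<omega> = 0"
  proof -
    have "(\<omega> ^ p - 1) * (\<Sum>i<p. (\<omega> ^ p) ^ i) = (\<omega> ^ p) ^ p - 1" by (rule power_diff_1_eq[symmetric])
    then have "(\<Sum>i<p. (\<omega> ^ p) ^ i) = 0" using w by (simp add: power_mult[symmetric])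
    then show ?thesis unfolding \<Phi>_def int_poly_eval_simps by (simp add: power_mult)
  qed
  have coPhi: "coeff \<Phi> n = (\<Sum>i<p. if p * i = n then 1 else 0)" for n
    unfolding \<Phi>_def by (simp add: coeff_sum)
  have degPhi: "degree \<Phi> = p * (p - 1)" and leadPhi: "coeff \<Phi> (p * (p - 1)) = 1"
  proof -
    have "(\<Sum>i<p. if p * i = p * (p - 1) then 1 else 0 :: int) = (\<Sum>i<p. if i = p - 1 then 1 else 0)"
      using p1 by (intro sum.cong) auto
    then show 1: "coeff \<Phi> (p * (p - 1)) = 1" using p1 by (simp add: coPhi)
    have "degree \<Phi> \<le> p * (p - 1)"
    proof (rule degree_le, intro allI impI)
      fix n assume n: "p * (p - 1) < n"
      have "p * i \<noteq> n" if "i < p" for i using that n mult_le_mono2[of i "p - 1" p] by auto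
      then show "coeff \<Phi> n = 0" by (simp add: coPhi)
    qed
    then show "degree \<Phi> = p * (p - 1)" using 1 le_degree[of \<Phi> "p * (p - 1)"] by simp
  qed
  have contPhi: "content \<Phi> = 1"
    using content_dvd_coeff[of \<Phi> "p * (p - 1)"] leadPhi by (metis is_unit_normalize normalize_content)
  \<comment> \<open>Pseudo-division stays over the integers. The remainder annihilates
    \<open>\<omega>\<close> in a degree below the minimum, so it is 0.\<close>
  define r where "r = pseudo_mod \<Phi> M"
  have M_nz: "M \<noteq> 0" using M by blast
  obtain a q where a: "a \<noteq> 0" "smult a \<Phi> = M * q + r" using pseudo_mod(1)[OF M_nz] unfolding r_def by blast
  have "int_poly_eval r \<omega> = 0"
    using arg_cong[OF a(2), of "\<lambda>P. int_poly_eval P \<omega>"] evPhi M unfolding int_poly_eval_simps by simp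
  then have "r = 0" using pseudo_mod(2)[OF M_nz, of \<Phi>] min[of r] degM unfolding r_def by fastforce
  then have aq: "smult a \<Phi> = M * q" using a by simp
  \<comment> \<open>Both \<open>\<Phi>\<close> and \<open>M\<close> have content 1, so passing to
    primitive parts removes the constant \<open>a\<close> up to its sign.\<close>
  have "smult (unit_factor a) \<Phi> = M * primitive_part q"
    using arg_cong[OF aq, of primitive_part]
    by (simp add: primitive_part_smult primitive_part_mult primitive_part_prim contPhi contM)
  then have "smult (unit_factor a) (smult (unit_factor a) \<Phi>) = M * smult (unit_factor a) (primitive_part q)"
    by simp
  moreover have "unit_factor a * unit_factor a = 1" using a(1) by (auto simp: sgn_if)
  ultimately obtain q' where q': "\<Phi> = M * q'" by (metis smult_1_left smult_smult)
  define F where "F = pcompose \<Phi> [:1, 1:]"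
  define A where "A = pcompose M [:1, 1:]"
  define B where "B = pcompose q' [:1, 1:]"
  have FAB: "F = A * B" unfolding F_def A_def B_def q' by (rule pcompose_mult)
  have degF: "degree F = p * (p - 1)" unfolding F_def by (simp add: degree_pcompose degPhi)
  define x :: "int poly" where "x = monom 1 1"
  define u where "u = (1 + x) ^ p"
  have xeq: "[:1, 1:] = 1 + x" by (simp add: x_def monom_Suc one_pCons)
  have Fu: "F = (\<Sum>i<p. u ^ i)"
    unfolding F_def \<Phi>_def u_def pcompose_sum
    by (intro sum.cong) (simp_all add: monom_altdef pcompose_hom.hom_power pcompose_smult pcompose_pCons xeq power_mult)
  \<comment> \<open>Modulo \<open>p\<close>, the identity \<open>F * (u - 1) = u ^ p - 1\<close> has
    \<open>x ^ p\<close> in place of \<open>u - 1\<close> and \<open>x ^ (p * p)\<close> on the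
    right.\<close>
  have "of_nat p dvd F * x ^ p - x ^ (p * p)"
  proof -
    have 1: "of_nat p dvd u - 1 - x ^ p" unfolding u_def by (rule prime_dvd_freshman[OF p])
    have "u - (1 + x ^ p) dvd u ^ p - (1 + x ^ p) ^ p"
      by (metis dvd_triv_left power_diff_sumr2)
    then have 2: "of_nat p dvd u ^ p - (1 + x ^ p) ^ p"
      using 1 by (metis diff_diff_eq dvd_trans)
    have 3: "of_nat p dvd (1 + x ^ p) ^ p - 1 - (x ^ p) ^ p" by (rule prime_dvd_freshman[OF p])
    have 4: "F * (u - 1) = u ^ p - 1" unfolding Fu by (simp add: power_diff_1_eq mult.commute)
    have "F * x ^ p - x ^ (p * p) = (u ^ p - (1 + x ^ p) ^ p) + ((1 + x ^ p) ^ p - 1 - (x ^ p) ^ p) - F * (u - 1 - x ^ p)"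
      using 4 by (simp add: algebra_simps power_mult)
    then show ?thesis using 1 2 3 by (simp only: dvd_diff dvd_add dvd_mult)
  qed
  then have dvdc: "int p dvd coeff (F * x ^ p - x ^ (p * p)) n" for n
    using const_poly_dvd_iff[of "int p" "F * x ^ p - x ^ (p * p)"] by (simp add: of_nat_poly)
  have low: "int p dvd coeff F i" if "i < degree F" for i
  proof -
    \<comment> \<open>The coefficient of \<open>F\<close> at \<open>i\<close> is that of
      \<open>F * x ^ p\<close> at \<open>i + p\<close>, and \<open>i < p * (p - 1)\<close> keeps it
      away from the term \<open>x ^ (p * p)\<close>.\<close>
    have "i + p \<noteq> p * p" using that degF p1 by (auto simp: right_diff_distrib')
    then show ?thesis
      using dvdc[of "i + p"] by (simp add: x_def x_pow_n monom_power coeff_monom_mult mult.commute[of F] coeff_monom)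
  qed
  have leadF: "lead_coeff F = 1"
    unfolding F_def using degPhi leadPhi by (subst lead_coeff_comp) auto
  \<comment> \<open>At 0 every \<open>u ^ i\<close> has the value 1, and there are \<open>p\<close>
    of them.\<close>
  have constF: "coeff F 0 = int p"
  proof -
    have "coeff F 0 = poly F 0" by (simp add: poly_0_coeff_0)
    then show ?thesis by (simp add: Fu u_def x_def poly_sum poly_monom)
  qed
  have pi: "Factorial_Ring.prime (int p)" using p by simp
  have "degree A = 0 \<or> degree B = 0"
  proof (rule eisenstein[OF pi])
    show "\<not> int p dvd lead_coeff (A * B)" using leadF p1 unfolding FAB[symmetric] by simp
    show "\<not> (int p)\<^sup>2 dvd coeff (A * B) 0"
    proof
      assume "(int p)\<^sup>2 dvd coeff (A * B) 0"
      then have "(int p)\<^sup>2 dvd int p" using constF FAB by simp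
      then have "p ^ 2 dvd p" by (metis of_nat_dvd_iff of_nat_power)
      then show False using p1 by (auto simp: power2_eq_square dest!: dvd_imp_le)
    qed
  qed (use low FAB in auto)
  \<comment> \<open>A nonzero constant cannot vanish at \<open>\<omega>\<close>. So it is
    \<open>B\<close> that is constant, and \<open>M\<close> has the full degree of
    \<open>\<Phi>\<close>.\<close>
  moreover have "degree A \<noteq> 0"
  proof
    assume "degree A = 0"
    then have "degree M = 0" by (simp add: A_def degree_pcompose)
    then obtain c where "M = [:c:]" by (rule degree_eq_zeroE)
    then show False using M by auto
  qed
  moreover have "A \<noteq> 0" "B \<noteq> 0" using leadF FAB by auto
  ultimately have "degree A = degree F" by (simp add: FAB degree_mult_eq)
  then have "degree M = p * (p - 1)" using degF by (simp add: A_def degree_pcompose)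
  then show ?thesis using min[of P] P degM by simp
qed

text \<open>The powers of \<open>\<xi>\<close> below \<open>p\<close> are distinct, since
  \<open>\<xi> ^ d = 1\<close> with \<open>d\<close> prime to \<open>p\<close> would give
  \<open>\<xi> = 1\<close>. Hence they exhaust the \<open>p\<close> roots of unity.\<close>

lemma prime_root_of_unity_powers:
  fixes \<xi> z :: complex
  assumes p: "Factorial_Ring.prime p" and x: "\<xi> ^ p = 1" "\<xi> \<noteq> 1" and z: "z ^ p = 1"
  obtains k where "k < p" "z = \<xi> ^ k"
proof -
  have p0: "0 < p" using p prime_gt_0_nat by blast
  have x0: "\<xi> \<noteq> 0" using x p0 by (auto simp: power_0_left)
  have ne: "\<xi> ^ d \<noteq> 1" if d: "0 < d" "d < p" for d
  proof
    assume *: "\<xi> ^ d = 1"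
    have "coprime d p" using p d by (metis coprime_commute nat_dvd_not_less prime_imp_coprime)
    moreover obtain g a b where "g dvd d" "g dvd p" "d * a = p * b + g"
      using bezout_add_strong_nat[of d p] d by auto
    ultimately have "d * a = p * b + 1" by (metis coprime_common_divisor_nat)
    then have "(\<xi> ^ d) ^ a = (\<xi> ^ p) ^ b * \<xi>" by (metis power_add power_mult power_one_right)
    then show False using * x by simp
  qed
  have "inj_on (\<lambda>k. \<xi> ^ k) {..<p}"
  proof (rule linorder_inj_onI)
    fix i j assume ij: "i < j" "i \<in> {..<p}" "j \<in> {..<p}"
    show "\<xi> ^ i \<noteq> \<xi> ^ j"
    proof
      assume "\<xi> ^ i = \<xi> ^ j"
      moreover have "\<xi> ^ j = \<xi> ^ i * \<xi> ^ (j - i)" using ij by (simp add: power_add[symmetric])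
      ultimately have "\<xi> ^ i * \<xi> ^ (j - i) = \<xi> ^ i * 1" by simp
      then show False using x0 ne[of "j - i"] ij by (auto simp: less_imp_diff_less)
    qed
  qed auto
  then have "card ((\<lambda>k. \<xi> ^ k) ` {..<p}) = p" by (simp add: card_image)
  moreover have "(\<lambda>k. \<xi> ^ k) ` {..<p} \<subseteq> {z. z ^ p = 1}"
    using x by (auto simp: power_mult[symmetric] mult.commute[of _ p] power_mult)
  moreover have "finite {z::complex. z ^ p = 1}" "card {z::complex. z ^ p = 1} = p"
    using p0 card_roots_unity_eq[of p] by (auto intro!: finite_roots_unity)
  ultimately have "(\<lambda>k. \<xi> ^ k) ` {..<p} = {z. z ^ p = 1}" by (intro card_subset_eq) auto
  then show ?thesis using that z by blast
qed

text \<open>Quotients of this shape form a field containing \<open>z\<close>. Integer coefficients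
  suffice because denominators can be cleared.\<close>

lemma rat_adjoin_fraction:
  assumes "x \<in> rat_adjoin z"
  obtains a b where "int_poly_eval b z \<noteq> 0" "x = int_poly_eval a z / int_poly_eval b z"
proof -
  let ?R = "ring_of_type_algebra :: complex ring"
  have fld: "field ?R" by (rule field_from_type_algebra)
  then interpret R: field ?R .
  have s: "\<one>\<^bsub>?R\<^esub> = 1" "\<zero>\<^bsub>?R\<^esub> = 0" "h1 \<oplus>\<^bsub>?R\<^esub> h2 = h1 + h2" "h1 \<otimes>\<^bsub>?R\<^esub> h2 = h1 * h2" "carrier ?R = UNIV" for h1 h2
    by (simp_all add: ring_of_type_algebra_def)
  have ainv: "\<ominus>\<^bsub>?R\<^esub> h = - h" for h
    using R.l_neg[of h] by (simp add: s eq_neg_iff_add_eq_0)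
  have minv: "inv\<^bsub>?R\<^esub> h = inverse h" if "h \<noteq> 0" for h
    using R.comm_inv_char[of h "inverse h"] that by (simp add: s)
  have "\<exists>a b. int_poly_eval b z \<noteq> 0 \<and> x = int_poly_eval a z / int_poly_eval b z"
    using assms unfolding rat_adjoin_def
  proof induction
    case one
    then show ?case by (intro exI[of _ 1]) (simp add: s)
  next
    case (incl h)
    then show ?case by - (rule exI[of _ "monom 1 1"], rule exI[of _ 1], simp add: poly_monom)
  next
    case (a_inv h)
    then obtain a b where "int_poly_eval b z \<noteq> 0" "h = int_poly_eval a z / int_poly_eval b z" by blast
    then show ?case by - (rule exI[of _ "- a"], rule exI[of _ b], simp add: ainv int_poly_eval_simps)
  next
    case (m_inv h)
    then obtain a b where "int_poly_eval b z \<noteq> 0" "h = int_poly_eval a z / int_poly_eval b z" by blast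
    moreover have "h \<noteq> 0" using m_inv by (simp add: s)
    ultimately show ?case by - (rule exI[of _ b], rule exI[of _ a], auto simp: minv)
  next
    case (eng_add h1 h2)
    then obtain a b a' b' where "int_poly_eval b z \<noteq> 0" "h1 = int_poly_eval a z / int_poly_eval b z"
      "int_poly_eval b' z \<noteq> 0" "h2 = int_poly_eval a' z / int_poly_eval b' z" by blast
    then show ?case
      by - (rule exI[of _ "a * b' + a' * b"], rule exI[of _ "b * b'"], simp add: s int_poly_eval_simps add_frac_eq algebra_simps)
  next
    case (eng_mult h1 h2)
    then obtain a b a' b' where "int_poly_eval b z \<noteq> 0" "h1 = int_poly_eval a z / int_poly_eval b z"
      "int_poly_eval b' z \<noteq> 0" "h2 = int_poly_eval a' z / int_poly_eval b' z" by blast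
    then show ?case
      by - (rule exI[of _ "a * a'"], rule exI[of _ "b * b'"], simp add: s int_poly_eval_simps)
  qed
  then show ?thesis using that by blast
qed

lemma rat_adjoin_closed:
  shows rat_adjoin_of_nat: "of_nat n \<in> rat_adjoin z"
    and rat_adjoin_power: "x \<in> rat_adjoin z \<Longrightarrow> x ^ n \<in> rat_adjoin z"
    and rat_adjoin_mult: "x \<in> rat_adjoin z \<Longrightarrow> y \<in> rat_adjoin z \<Longrightarrow> x * y \<in> rat_adjoin z"
    and rat_adjoin_divide: "x \<in> rat_adjoin z \<Longrightarrow> y \<in> rat_adjoin z \<Longrightarrow> y \<noteq> 0 \<Longrightarrow> x / y \<in> rat_adjoin z"
    and rat_adjoin_self: "z \<in> rat_adjoin z"
proof -
  let ?R = "ring_of_type_algebra :: complex ring"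
  have fld: "field ?R" by (rule field_from_type_algebra)
  then interpret R: field ?R .
  have s: "\<one>\<^bsub>?R\<^esub> = 1" "\<zero>\<^bsub>?R\<^esub> = 0" "h1 \<oplus>\<^bsub>?R\<^esub> h2 = h1 + h2" "h1 \<otimes>\<^bsub>?R\<^esub> h2 = h1 * h2" "carrier ?R = UNIV" for h1 h2
    by (simp_all add: ring_of_type_algebra_def)
  have ainv: "\<ominus>\<^bsub>?R\<^esub> h = - h" for h
    using R.l_neg[of h] by (simp add: s eq_neg_iff_add_eq_0)
  have minv: "inv\<^bsub>?R\<^esub> h = inverse h" if "h \<noteq> 0" for h
    using R.comm_inv_char[of h "inverse h"] that by (simp add: s)
  note gf = generate_field.intros[where R = ?R and H = "{z}", folded rat_adjoin_def, unfolded s]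
  show mult: "x * y \<in> rat_adjoin z" if "x \<in> rat_adjoin z" "y \<in> rat_adjoin z" for x y
    using gf(6) that by blast
  show "x / y \<in> rat_adjoin z" if "x \<in> rat_adjoin z" "y \<in> rat_adjoin z" "y \<noteq> 0" for x y
    using mult[OF that(1) gf(4)[OF that(2,3)]] minv[OF that(3)] by (simp add: divide_inverse)
  show "x ^ n \<in> rat_adjoin z" if "x \<in> rat_adjoin z" for x
    by (induction n) (use gf(1) mult that in auto)
  show "z \<in> rat_adjoin z" using gf(2) by blast
  have zero: "0 \<in> rat_adjoin z" using gf(5)[OF gf(1) gf(3)[OF gf(1)]] by (simp add: ainv)
  show "of_nat n \<in> rat_adjoin z"
    by (induction n) (use zero gf(1,5) in auto)
qed

text \<open>The polynomial \<open>1 + x + ... + x ^ (p - 1)\<close> vanishes at \<open>\<xi>\<close>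
  and is monic, so division by it leaves an integer remainder with the same value there.\<close>

lemma int_poly_reduce_cyclotomic:
  fixes \<xi> :: complex
  assumes p: "1 < p" and x: "\<xi> ^ p = 1" "\<xi> \<noteq> 1"
  obtains r where "degree r < p - 1" "int_poly_eval r \<xi> = int_poly_eval a \<xi>"
proof -
  define \<Psi> :: "int poly" where "\<Psi> = (\<Sum>i<p. monom 1 i)"
  have ev: "int_poly_eval \<Psi> \<xi> = 0"
  proof -
    have "(\<xi> - 1) * (\<Sum>i<p. \<xi> ^ i) = \<xi> ^ p - 1" by (rule power_diff_1_eq[symmetric])
    then show ?thesis using x unfolding \<Psi>_def int_poly_eval_simps by simp
  qed
  have co: "coeff \<Psi> n = (if n < p then 1 else 0)" for n
    unfolding \<Psi>_def by (simp add: coeff_sum)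
  have "degree \<Psi> \<le> p - 1" by (rule degree_le) (use p co in auto)
  moreover have "p - 1 \<le> degree \<Psi>" by (rule le_degree) (use p co in auto)
  ultimately have deg: "degree \<Psi> = p - 1" by simp
  have nz: "\<Psi> \<noteq> 0" using deg p by auto
  obtain q r where qr: "pseudo_divmod a \<Psi> = (q, r)" by (cases "pseudo_divmod a \<Psi>")
  have "a = \<Psi> * q + r" using pseudo_divmod(1)[OF nz qr] deg co p by simp
  then have "int_poly_eval a \<xi> = int_poly_eval r \<xi>"
    using ev by (simp only: int_poly_eval_simps mult_zero_left add_0_left)
  moreover have "degree r < p - 1" using pseudo_divmod(2)[OF nz qr] deg p by auto
  ultimately show ?thesis using that by metis
qed

text \<open>If \<open>\<omega>\<^sup>p = \<xi> \<noteq> 1\<close> and \<open>\<omega> = a(\<xi>)/b(\<xi>)\<close> with \<open>a\<close>, \<open>b\<close> of degree less than \<open>p - 1\<close>, then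
  \<open>x b(x\<^sup>p) - a(x\<^sup>p)\<close> annihilates \<open>\<omega>\<close> although its degree is less than \<open>p(p - 1)\<close>.\<close>

lemma rat_adjoin_no_order_prime_square:
  fixes \<omega> \<zeta> :: complex
  assumes p: "Factorial_Ring.prime p" and z: "\<zeta> ^ p = 1" and w: "\<omega> \<in> rat_adjoin \<zeta>" "\<omega> ^ (p * p) = 1"
  shows "\<omega> ^ p = 1"
proof (rule ccontr)
  assume ne: "\<omega> ^ p \<noteq> 1"
  have p1: "1 < p" using p prime_gt_1_nat by blast
  define \<xi> where "\<xi> = \<omega> ^ p"
  have xi: "\<xi> ^ p = 1" "\<xi> \<noteq> 1" using w ne by (simp_all add: \<xi>_def power_mult)
  \<comment> \<open>Through \<open>\<zeta> = \<xi> ^ m\<close> the numerator and denominator of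
    \<open>\<omega>\<close> become polynomials in \<open>\<xi> = \<omega> ^ p\<close>.\<close>
  obtain m where m: "\<zeta> = \<xi> ^ m" using prime_root_of_unity_powers[OF p xi z] by blast
  obtain a b where ab: "int_poly_eval b \<zeta> \<noteq> 0" "\<omega> = int_poly_eval a \<zeta> / int_poly_eval b \<zeta>"
    using rat_adjoin_fraction[OF w(1)] by blast
  have conv: "int_poly_eval (pcompose c (monom 1 m)) \<xi> = int_poly_eval c \<zeta>" for c
    by (simp add: int_poly_eval_simps m poly_monom)
  obtain a' where a': "degree a' < p - 1" "int_poly_eval a' \<xi> = int_poly_eval a \<zeta>"
    using int_poly_reduce_cyclotomic[OF p1 xi, of "pcompose a (monom 1 m)"] conv by metis
  obtain b' where b': "degree b' < p - 1" "int_poly_eval b' \<xi> = int_poly_eval b \<zeta>"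
    using int_poly_reduce_cyclotomic[OF p1 xi, of "pcompose b (monom 1 m)"] conv by metis
  let ?A = "pcompose a' (monom 1 p)" and ?B = "pcompose b' (monom 1 p)"
  define P where "P = monom 1 1 * ?B - ?A"
  have degA: "degree ?A = p * degree a'" and degB: "degree ?B = p * degree b'"
    by (simp_all add: degree_pcompose degree_monom_eq)
  have b0: "b' \<noteq> 0" using b' ab by auto
  have B0: "?B \<noteq> 0"
  proof
    assume "?B = 0"
    then have "int_poly_eval ?B \<omega> = 0" by simp
    then show False using ab(1) b'(2) by (simp add: int_poly_eval_simps poly_monom \<xi>_def)
  qed
  have deg1: "degree (monom 1 1 * ?B) = 1 + p * degree b'"
    using B0 degB by (subst degree_mult_eq) (auto simp: degree_monom_eq)
  \<comment> \<open>The two terms cannot cancel: the degree of the first is 1 modulo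
    \<open>p\<close>, that of the second is 0.\<close>
  have "P \<noteq> 0"
  proof
    assume "P = 0"
    then have "1 + p * degree b' = p * degree a'" using deg1 degA by (simp add: P_def)
    then have "p dvd 1" by (metis dvd_add_left_iff dvd_triv_left)
    then show False using p1 by simp
  qed
  moreover have "int_poly_eval P \<omega> = 0"
    using ab a' b' by (simp add: P_def int_poly_eval_simps poly_monom \<xi>_def field_simps)
  ultimately have "p * (p - 1) \<le> degree P"
    using degree_ge_of_order_prime_square[OF p w(2) ne] by blast
  also have "degree P \<le> 1 + p * (p - 2)"
    unfolding P_def
  proof (rule degree_diff_le)
    have "p * degree b' \<le> p * (p - 2)" using b'(1) by (intro mult_le_mono2) simp
    then show "degree (monom 1 1 * ?B) \<le> 1 + p * (p - 2)" using deg1 by linarith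
    have "p * degree a' \<le> p * (p - 2)" using a'(1) by (intro mult_le_mono2) simp
    then show "degree ?A \<le> 1 + p * (p - 2)" using degA by linarith
  qed
  also have "\<dots> < p * (p - 1)"
  proof -
    obtain q where "p = q + 2" using p1 by (metis add.commute le_Suc_ex Suc_1 Suc_leI)
    then show ?thesis by simp
  qed
  finally show False by simp
qed

section \<open>Kernel, center and central character\<close>

definition rep_char :: "('a, 'b) monoid_scheme \<Rightarrow> ('a \<Rightarrow> complex mat) \<Rightarrow> 'a \<Rightarrow> complex" where
  "rep_char G \<rho> = restrict (\<lambda>g. mat_trace (\<rho> g)) (carrier G)"

text \<open>For normal \<open>N\<close>, the preimage of the center of \<open>G Mod N\<close>,
  described by commutators so that it lives inside \<open>G\<close>.\<close>

definition center_modulo :: "('a, 'b) monoid_scheme \<Rightarrow> 'a set \<Rightarrow> 'a set" where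
  "center_modulo G N = {z \<in> carrier G. \<forall>g\<in>carrier G. g \<otimes>\<^bsub>G\<^esub> z \<otimes>\<^bsub>G\<^esub> inv\<^bsub>G\<^esub> g \<otimes>\<^bsub>G\<^esub> inv\<^bsub>G\<^esub> z \<in> N}"

lemma rep_char_apply: "g \<in> carrier G \<Longrightarrow> rep_char G \<rho> g = mat_trace (\<rho> g)"
  by (simp add: rep_char_def)

lemma Irr_eq: "Irr G = {rep_char G \<rho> | n \<rho>. irreducible_rep G n \<rho>}"
  by (simp add: Irr_def rep_char_def)

lemma mat_trace_smult_one [simp]: "mat_trace (c \<cdot>\<^sub>m 1\<^sub>m n) = c * of_nat n"
  using mat_trace_smult[OF one_carrier_mat] by simp

lemma smult_one_mat_eq_iff:
  fixes c d :: complex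
  assumes "0 < n"
  shows "c \<cdot>\<^sub>m 1\<^sub>m n = d \<cdot>\<^sub>m 1\<^sub>m n \<longleftrightarrow> c = d"
proof
  assume "c \<cdot>\<^sub>m 1\<^sub>m n = d \<cdot>\<^sub>m 1\<^sub>m n"
  then have "(c \<cdot>\<^sub>m 1\<^sub>m n) $$ (0, 0) = (d \<cdot>\<^sub>m 1\<^sub>m n) $$ (0, 0)" by simp
  then show "c = d" using assms by simp
qed simp

text \<open>Each closure property rests on an identity that builds the required commutator from
  commutators in \<open>N\<close> by products, inverses and conjugation.\<close>

lemma (in group) center_modulo_normal:
  assumes N: "N \<lhd> G"
  shows "center_modulo G N \<lhd> G" "N \<subseteq> center_modulo G N"
proof -
  interpret N: normal N G by (rule N)
  have conjN: "g \<otimes> n \<otimes> inv g \<in> N" if "g \<in> carrier G" "n \<in> N" for g n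
    using N.inv_op_closed2 that by blast
  have memD: "z \<in> carrier G" "\<And>g. g \<in> carrier G \<Longrightarrow> g \<otimes> z \<otimes> inv g \<otimes> inv z \<in> N" if "z \<in> center_modulo G N" for z
    using that by (auto simp: center_modulo_def)
  have "subgroup (center_modulo G N) G"
  proof (rule subgroupI)
    show "center_modulo G N \<subseteq> carrier G" by (auto simp: center_modulo_def)
    have "\<one> \<in> center_modulo G N" by (auto simp: center_modulo_def)
    then show "center_modulo G N \<noteq> {}" by blast
  next
    fix a assume a: "a \<in> center_modulo G N"
    note a = memD[OF a]
    have "g \<otimes> inv a \<otimes> inv g \<otimes> inv (inv a) \<in> N" if g: "g \<in> carrier G" for g
    proof -
      have "inv a \<otimes> inv (g \<otimes> a \<otimes> inv g \<otimes> inv a) \<otimes> inv (inv a) \<in> N"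
        using a g by (intro conjN N.m_inv_closed) auto
      moreover have "inv a \<otimes> inv (g \<otimes> a \<otimes> inv g \<otimes> inv a) \<otimes> inv (inv a) = g \<otimes> inv a \<otimes> inv g \<otimes> inv (inv a)"
        using a g by (simp add: inv_mult_group m_assoc[symmetric])
      ultimately show ?thesis by simp
    qed
    then show "inv a \<in> center_modulo G N" using a by (auto simp: center_modulo_def)
  next
    fix a b assume a: "a \<in> center_modulo G N" and b: "b \<in> center_modulo G N"
    note a = memD[OF a] and b = memD[OF b]
    have "g \<otimes> (a \<otimes> b) \<otimes> inv g \<otimes> inv (a \<otimes> b) \<in> N" if g: "g \<in> carrier G" for g
    proof -
      \<comment> \<open>With \<open>[g, z]\<close> for the commutator, \<open>[g, a b]\<close> is
        \<open>[g, a]\<close> times the conjugate of \<open>[g, b]\<close> by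
        \<open>a\<close>.\<close>
      have "(g \<otimes> a \<otimes> inv g \<otimes> inv a) \<otimes> (a \<otimes> (g \<otimes> b \<otimes> inv g \<otimes> inv b) \<otimes> inv a) \<in> N"
        by (rule N.m_closed[OF a(2)[OF g] conjN[OF a(1) b(2)[OF g]]])
      moreover have "(g \<otimes> a \<otimes> inv g \<otimes> inv a) \<otimes> (a \<otimes> (g \<otimes> b \<otimes> inv g \<otimes> inv b) \<otimes> inv a) =
          g \<otimes> (a \<otimes> b) \<otimes> inv g \<otimes> inv (a \<otimes> b)"
      proof -
        have 1: "inv a \<otimes> (a \<otimes> t) = t" "inv g \<otimes> (g \<otimes> t) = t" if "t \<in> carrier G" for t
          using a(1) g that by (simp_all add: m_assoc[symmetric])
        show ?thesis using a b g 1 by (simp add: inv_mult_group m_assoc)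
      qed
      ultimately show ?thesis by simp
    qed
    then show "a \<otimes> b \<in> center_modulo G N" using a b by (auto simp: center_modulo_def)
  qed
  moreover have "x \<otimes> z \<otimes> inv x \<in> center_modulo G N" if z: "z \<in> center_modulo G N" and x: "x \<in> carrier G" for x z
  proof -
    note z = memD[OF z]
    have "g \<otimes> (x \<otimes> z \<otimes> inv x) \<otimes> inv g \<otimes> inv (x \<otimes> z \<otimes> inv x) \<in> N" if g: "g \<in> carrier G" for g
    proof -
      \<comment> \<open>The commutator of \<open>g\<close> with the conjugate of \<open>z\<close> by
        \<open>x\<close> is \<open>[g x, z]\<close> times the inverse of
        \<open>[x, z]\<close>.\<close>
      have "((g \<otimes> x) \<otimes> z \<otimes> inv (g \<otimes> x) \<otimes> inv z) \<otimes> inv (x \<otimes> z \<otimes> inv x \<otimes> inv z) \<in> N"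
        by (rule N.m_closed[OF z(2)[OF m_closed[OF g x]] N.m_inv_closed[OF z(2)[OF x]]])
      moreover have "((g \<otimes> x) \<otimes> z \<otimes> inv (g \<otimes> x) \<otimes> inv z) \<otimes> inv (x \<otimes> z \<otimes> inv x \<otimes> inv z) =
          g \<otimes> (x \<otimes> z \<otimes> inv x) \<otimes> inv g \<otimes> inv (x \<otimes> z \<otimes> inv x)"
      proof -
        have 1: "inv z \<otimes> (z \<otimes> t) = t" if "t \<in> carrier G" for t
          using z(1) that by (simp add: m_assoc[symmetric])
        show ?thesis using z x g 1 by (simp add: inv_mult_group m_assoc)
      qed
      ultimately show ?thesis by simp
    qed
    then show ?thesis using z x by (auto simp: center_modulo_def)
  qed
  ultimately show "center_modulo G N \<lhd> G" by (rule normal_invI)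
  show "N \<subseteq> center_modulo G N"
  proof
    fix n assume n: "n \<in> N"
    then have "g \<otimes> n \<otimes> inv g \<otimes> inv n \<in> N" if "g \<in> carrier G" for g
      using conjN[OF that n] by simp
    then show "n \<in> center_modulo G N" using n N.subset by (auto simp: center_modulo_def)
  qed
qed

section \<open>Kernel and center of a character in terms of matrices\<close>

lemma (in group) rep_char_one:
  assumes "irreducible_rep G n \<rho>"
  shows "rep_char G \<rho> \<one> = of_nat n"
  using matrix_repD(3)[OF irreducible_rep_matrix_rep[OF assms]] by (simp add: rep_char_apply)

lemma (in group) scalar_root_of_unity:
  assumes fin: "finite (carrier G)" and irr: "irreducible_rep G n \<rho>" and g: "g \<in> carrier G"
    and c: "\<rho> g = c \<cdot>\<^sub>m 1\<^sub>m n"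
  shows "c ^ Coset.order G = 1"
proof -
  have n: "0 < n" using irr by (simp add: irreducible_rep_def)
  have "(c \<cdot>\<^sub>m 1\<^sub>m n) ^\<^sub>m k = c ^ k \<cdot>\<^sub>m 1\<^sub>m n" for k
  proof (induction k)
    case (Suc k)
    have "(c \<cdot>\<^sub>m 1\<^sub>m n) ^\<^sub>m Suc k = (c ^ k \<cdot>\<^sub>m 1\<^sub>m n) * (c \<cdot>\<^sub>m 1\<^sub>m n)" using Suc by simp
    also have "\<dots> = c ^ Suc k \<cdot>\<^sub>m 1\<^sub>m n"
      by (rule eq_matI) (auto simp: mult_smult_assoc_mat[of "1\<^sub>m n" n n _ n])
    finally show ?case .
  qed (auto intro: eq_matI)
  then have "c ^ Coset.order G \<cdot>\<^sub>m 1\<^sub>m n = 1 \<cdot>\<^sub>m 1\<^sub>m n"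
    using matrix_rep_finite_order(1)[OF fin irreducible_rep_matrix_rep[OF irr] g] c by (auto intro: eq_matI)
  then show ?thesis using smult_one_mat_eq_iff[OF n] by blast
qed

text \<open>A trace equal to the degree attains the bound of the triangle inequality, so the matrix
  is scalar, and the scalar must be 1.\<close>

lemma (in group) char_ker_eq:
  assumes fin: "finite (carrier G)" and irr: "irreducible_rep G n \<rho>"
  shows "char_ker G (rep_char G \<rho>) = {g \<in> carrier G. \<rho> g = 1\<^sub>m n}"
proof -
  note rep = irreducible_rep_matrix_rep[OF irr]
  have n: "0 < n" using irr by (simp add: irreducible_rep_def)
  have one: "\<rho> g = 1\<^sub>m n" if g: "g \<in> carrier G" and tr: "mat_trace (\<rho> g) = of_nat n" for g
  proof -
    obtain c where c: "\<rho> g = c \<cdot>\<^sub>m 1\<^sub>m n" using scalar_of_cmod_trace[OF fin rep g] tr by auto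
    then have "c = 1" using tr n by simp
    then show ?thesis using c by (auto intro: eq_matI)
  qed
  have "rep_char G \<rho> g = of_nat n \<longleftrightarrow> \<rho> g = 1\<^sub>m n" if g: "g \<in> carrier G" for g
    unfolding rep_char_apply[OF g] using one[OF g] mat_trace_one by metis
  then show ?thesis unfolding char_ker_def rep_char_one[OF irr] by blast
qed

lemma (in group) char_ker_normal:
  assumes fin: "finite (carrier G)" and irr: "irreducible_rep G n \<rho>"
  shows "char_ker G (rep_char G \<rho>) \<lhd> G"
proof -
  note rep = irreducible_rep_matrix_rep[OF irr]
  note r = matrix_repD[OF rep]
  have inv1: "\<rho> (inv a) = 1\<^sub>m n" if "a \<in> carrier G" "\<rho> a = 1\<^sub>m n" for a
    using r(2)[of a "inv a"] r(1)[of "inv a"] r(3) that by simp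
  show ?thesis
    unfolding char_ker_eq[OF fin irr]
  proof (rule normal_invI)
    show "subgroup {g \<in> carrier G. \<rho> g = 1\<^sub>m n} G"
      by (rule subgroupI) (use r inv1 in auto)
    fix a x assume "a \<in> {g \<in> carrier G. \<rho> g = 1\<^sub>m n}" and x: "x \<in> carrier G"
    then have a: "a \<in> carrier G" "\<rho> a = 1\<^sub>m n" by auto
    have "\<rho> (x \<otimes> a \<otimes> inv x) = \<rho> x * \<rho> (inv x)"
      using r(2) a x by (simp add: right_mult_one_mat[OF r(1)[OF x]])
    also have "\<dots> = 1\<^sub>m n" using r(2)[of x "inv x"] r(3) x by simp
    finally show "x \<otimes> a \<otimes> inv x \<in> {g \<in> carrier G. \<rho> g = 1\<^sub>m n}" using a x by simp
  qed
qed

lemma (in group) char_center_iff_scalar: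
  assumes fin: "finite (carrier G)" and irr: "irreducible_rep G n \<rho>" and g: "g \<in> carrier G"
  shows "g \<in> char_center G (rep_char G \<rho>) \<longleftrightarrow> (\<exists>c. \<rho> g = c \<cdot>\<^sub>m 1\<^sub>m n)"
proof
  note rep = irreducible_rep_matrix_rep[OF irr]
  assume "g \<in> char_center G (rep_char G \<rho>)"
  then have "complex_of_real (cmod (mat_trace (\<rho> g))) = of_nat n"
    using g by (simp add: char_center_def rep_char_one[OF irr] rep_char_apply)
  then have "cmod (mat_trace (\<rho> g)) = n" by (metis of_real_eq_iff of_real_of_nat_eq)
  then show "\<exists>c. \<rho> g = c \<cdot>\<^sub>m 1\<^sub>m n" using scalar_of_cmod_trace[OF fin rep g] by metis
next
  assume "\<exists>c. \<rho> g = c \<cdot>\<^sub>m 1\<^sub>m n"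
  then obtain c where c: "\<rho> g = c \<cdot>\<^sub>m 1\<^sub>m n" by blast
  have "c ^ Coset.order G = 1" by (rule scalar_root_of_unity[OF fin irr g c])
  moreover have "0 < Coset.order G" using fin order_gt_0_iff_finite by blast
  ultimately have "cmod c = 1" using norm_power[of c "Coset.order G"] power_eq_1_iff by (metis norm_ge_zero norm_one abs_of_nonneg neq0_conv power_eq_1_iff)
  then show "g \<in> char_center G (rep_char G \<rho>)"
    using g c by (simp add: char_center_def rep_char_one[OF irr] rep_char_apply norm_mult)
qed

text \<open>By Schur's lemma \<open>\<rho> z\<close> is scalar iff it commutes with all
  \<open>\<rho> g\<close>, that is, iff the commutators of \<open>z\<close> lie in the kernel. So
  the center of a character depends on its kernel alone.\<close>

lemma (in group) char_center_eq:
  assumes fin: "finite (carrier G)" and irr: "irreducible_rep G n \<rho>"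
  shows "char_center G (rep_char G \<rho>) = center_modulo G (char_ker G (rep_char G \<rho>))"
proof -
  note r = matrix_repD[OF irreducible_rep_matrix_rep[OF irr]]
  have comm_iff: "\<rho> (g \<otimes> z \<otimes> inv g \<otimes> inv z) = 1\<^sub>m n \<longleftrightarrow> \<rho> g * \<rho> z = \<rho> z * \<rho> g"
    if g: "g \<in> carrier G" and z: "z \<in> carrier G" for g z
  proof
    assume "\<rho> (g \<otimes> z \<otimes> inv g \<otimes> inv z) = 1\<^sub>m n"
    moreover have "g \<otimes> z = (g \<otimes> z \<otimes> inv g \<otimes> inv z) \<otimes> (z \<otimes> g)"
    proof -
      have 1: "inv z \<otimes> (z \<otimes> t) = t" if "t \<in> carrier G" for t
        using z that by (simp add: m_assoc[symmetric])
      show ?thesis using g z 1 by (simp add: m_assoc)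
    qed
    ultimately have "\<rho> (g \<otimes> z) = 1\<^sub>m n * \<rho> (z \<otimes> g)"
      using r(2)[of "g \<otimes> z \<otimes> inv g \<otimes> inv z" "z \<otimes> g"] g z by simp
    then show "\<rho> g * \<rho> z = \<rho> z * \<rho> g" using left_mult_one_mat[OF r(1)[of "z \<otimes> g"]] r(2) g z by simp
  next
    assume "\<rho> g * \<rho> z = \<rho> z * \<rho> g"
    then have "\<rho> (g \<otimes> z) = \<rho> (z \<otimes> g)" using r(2) g z by simp
    moreover have "g \<otimes> z \<otimes> inv g \<otimes> inv z = (g \<otimes> z) \<otimes> inv (z \<otimes> g)"
      using g z by (simp add: inv_mult_group m_assoc)
    ultimately have "\<rho> (g \<otimes> z \<otimes> inv g \<otimes> inv z) = \<rho> (z \<otimes> g) * \<rho> (inv (z \<otimes> g))"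
      using r(2)[of "g \<otimes> z" "inv (z \<otimes> g)"] g z by simp
    also have "\<dots> = \<rho> \<one>" using r(2)[of "z \<otimes> g" "inv (z \<otimes> g)"] g z by simp
    finally show "\<rho> (g \<otimes> z \<otimes> inv g \<otimes> inv z) = 1\<^sub>m n" using r(3) by simp
  qed
  have "(\<exists>c. \<rho> z = c \<cdot>\<^sub>m 1\<^sub>m n) \<longleftrightarrow> (\<forall>g\<in>carrier G. \<rho> g * \<rho> z = \<rho> z * \<rho> g)" if z: "z \<in> carrier G" for z
  proof
    assume "\<exists>c. \<rho> z = c \<cdot>\<^sub>m 1\<^sub>m n"
    then obtain c where c: "\<rho> z = c \<cdot>\<^sub>m 1\<^sub>m n" by blast
    show "\<forall>g\<in>carrier G. \<rho> g * \<rho> z = \<rho> z * \<rho> g"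
    proof
      fix g assume g: "g \<in> carrier G"
      show "\<rho> g * \<rho> z = \<rho> z * \<rho> g"
        using mult_smult_distrib[OF r(1)[OF g] one_carrier_mat, of c] mult_smult_assoc_mat[OF one_carrier_mat r(1)[OF g], of c]
          r(1)[OF g] by (simp add: c)
    qed
  next
    assume "\<forall>g\<in>carrier G. \<rho> g * \<rho> z = \<rho> z * \<rho> g"
    then show "\<exists>c. \<rho> z = c \<cdot>\<^sub>m 1\<^sub>m n" using schur_scalar[OF irr r(1)[OF z]] by metis
  qed
  then have "z \<in> char_center G (rep_char G \<rho>) \<longleftrightarrow> z \<in> center_modulo G (char_ker G (rep_char G \<rho>))" if "z \<in> carrier G" for z
    using char_center_iff_scalar[OF fin irr that] comm_iff that
    by (auto simp: center_modulo_def char_ker_eq[OF fin irr])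
  moreover have "char_center G (rep_char G \<rho>) \<subseteq> carrier G" by (auto simp: char_center_def)
  moreover have "center_modulo G (char_ker G (rep_char G \<rho>)) \<subseteq> carrier G" by (auto simp: center_modulo_def)
  ultimately show ?thesis by blast
qed

text \<open>The scalars by which the center acts form a linear character, invariant under
  conjugation and with kernel \<open>N\<close>. The properties are those used by
  \<open>characters_over\<close> and by the counting arguments.\<close>

lemma (in group) central_character:
  assumes fin: "finite (carrier G)" and irr: "irreducible_rep G n \<rho>"
  defines "N \<equiv> char_ker G (rep_char G \<rho>)"
  obtains lam where "\<And>z. z \<in> center_modulo G N \<Longrightarrow> \<rho> z = lam z \<cdot>\<^sub>m 1\<^sub>m n"
    and "\<And>z. z \<in> center_modulo G N \<Longrightarrow> rep_char G \<rho> z = of_nat n * lam z"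
    and "\<And>x y. x \<in> center_modulo G N \<Longrightarrow> y \<in> center_modulo G N \<Longrightarrow> lam (x \<otimes> y) = lam x * lam y"
    and "lam \<one> = 1"
    and "\<And>g z. g \<in> carrier G \<Longrightarrow> z \<in> center_modulo G N \<Longrightarrow> lam (g \<otimes> z \<otimes> inv g) = lam z"
    and "\<And>z. z \<in> center_modulo G N \<Longrightarrow> lam z ^ Coset.order G = 1"
    and "\<And>z. z \<in> center_modulo G N \<Longrightarrow> lam z = 1 \<longleftrightarrow> z \<in> N"
proof -
  let ?Z = "center_modulo G N"
  note r = matrix_repD[OF irreducible_rep_matrix_rep[OF irr]]
  have n: "0 < n" using irr by (simp add: irreducible_rep_def)
  have NG: "N \<lhd> G" unfolding N_def by (rule char_ker_normal[OF fin irr])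
  interpret Z: normal ?Z G by (rule center_modulo_normal[OF NG])
  have Zc: "z \<in> carrier G" if "z \<in> ?Z" for z using that Z.subset by blast
  define lam where "lam z = (SOME c. \<rho> z = c \<cdot>\<^sub>m 1\<^sub>m n)" for z
  have sc: "\<rho> z = lam z \<cdot>\<^sub>m 1\<^sub>m n" if z: "z \<in> ?Z" for z
  proof -
    have "\<exists>c. \<rho> z = c \<cdot>\<^sub>m 1\<^sub>m n"
      using char_center_iff_scalar[OF fin irr Zc[OF z]] z char_center_eq[OF fin irr] unfolding N_def by simp
    then show ?thesis unfolding lam_def by (rule someI_ex)
  qed
  have eqI: "c = d" if "c \<cdot>\<^sub>m 1\<^sub>m n = d \<cdot>\<^sub>m 1\<^sub>m n" for c d :: complex
    using smult_one_mat_eq_iff[OF n] that by blast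
  have sm: "(c \<cdot>\<^sub>m 1\<^sub>m n) * A = c \<cdot>\<^sub>m A" if "A \<in> carrier_mat n n" for c and A :: "complex mat"
    using mult_smult_assoc_mat[OF one_carrier_mat that, of c] that by simp
  show ?thesis
  proof
    show "\<rho> z = lam z \<cdot>\<^sub>m 1\<^sub>m n" if "z \<in> ?Z" for z by (rule sc[OF that])
    show "rep_char G \<rho> z = of_nat n * lam z" if z: "z \<in> ?Z" for z
      using sc[OF z] Zc[OF z] by (simp add: rep_char_apply)
    show "lam (x \<otimes> y) = lam x * lam y" if x: "x \<in> ?Z" and y: "y \<in> ?Z" for x y
    proof (rule eqI)
      have "lam (x \<otimes> y) \<cdot>\<^sub>m 1\<^sub>m n = \<rho> x * \<rho> y"
        using sc[of "x \<otimes> y"] r(2)[OF Zc Zc] x y by simp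
      also have "\<dots> = lam x \<cdot>\<^sub>m \<rho> y" using sc[OF x] sm[OF r(1)[OF Zc[OF y]]] by simp
      also have "\<dots> = (lam x * lam y) \<cdot>\<^sub>m 1\<^sub>m n" by (subst sc[OF y]) (auto intro: eq_matI)
      finally show "lam (x \<otimes> y) \<cdot>\<^sub>m 1\<^sub>m n = (lam x * lam y) \<cdot>\<^sub>m 1\<^sub>m n" .
    qed
    show "lam \<one> = 1"
    proof (rule eqI)
      show "lam \<one> \<cdot>\<^sub>m 1\<^sub>m n = 1 \<cdot>\<^sub>m 1\<^sub>m n"
        using sc[OF Z.one_closed] r(3) by (auto intro: eq_matI)
    qed
    show "lam (g \<otimes> z \<otimes> inv g) = lam z" if g: "g \<in> carrier G" and z: "z \<in> ?Z" for g z
    proof (rule eqI)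
      have "lam (g \<otimes> z \<otimes> inv g) \<cdot>\<^sub>m 1\<^sub>m n = \<rho> g * \<rho> z * \<rho> (inv g)"
        using sc[OF Z.inv_op_closed2[OF g z]] r(2) g Zc[OF z] by simp
      also have "\<dots> = lam z \<cdot>\<^sub>m (\<rho> g * \<rho> (inv g))"
        using mult_smult_distrib[OF r(1)[OF g] one_carrier_mat, of "lam z"] mult_smult_assoc_mat[OF r(1)[OF g] r(1)[OF inv_closed[OF g]], of "lam z"] r(1)[OF g]
        by (simp add: sc[OF z])
      also have "\<rho> g * \<rho> (inv g) = 1\<^sub>m n" using r(2)[of g "inv g"] r(3) g by simp
      finally show "lam (g \<otimes> z \<otimes> inv g) \<cdot>\<^sub>m 1\<^sub>m n = lam z \<cdot>\<^sub>m 1\<^sub>m n" .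
    qed
    show "lam z ^ Coset.order G = 1" if z: "z \<in> ?Z" for z
      by (rule scalar_root_of_unity[OF fin irr Zc[OF z] sc[OF z]])
    show "lam z = 1 \<longleftrightarrow> z \<in> N" if z: "z \<in> ?Z" for z
    proof -
      have "z \<in> N \<longleftrightarrow> lam z \<cdot>\<^sub>m 1\<^sub>m n = 1 \<cdot>\<^sub>m (1\<^sub>m n :: complex mat)"
        unfolding N_def char_ker_eq[OF fin irr] using sc[OF z] Zc[OF z] by (auto intro!: eq_matI)
      then show ?thesis using smult_one_mat_eq_iff[OF n] by blast
    qed
  qed
qed

text \<open>The squared moduli add up to the order of \<open>G\<close>, of which the center
  contributes \<open>card Z * n ^ 2\<close>. The rest is 0 exactly if \<open>n ^ 2\<close> is the
  index of \<open>Z\<close>.\<close>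

lemma (in group) vanishing_iff_index:
  assumes fin: "finite (carrier G)" and irr: "irreducible_rep G n \<rho>"
  defines "Z \<equiv> char_center G (rep_char G \<rho>)"
  shows "(\<forall>g\<in>carrier G - Z. rep_char G \<rho> g = 0) \<longleftrightarrow>
    rep_char G \<rho> \<one> = complex_of_real (sqrt (real (card (rcosets Z))))"
proof -
  have n: "0 < n" using irr by (simp add: irreducible_rep_def)
  have "Z \<lhd> G"
    unfolding Z_def char_center_eq[OF fin irr] by (rule center_modulo_normal(1)[OF char_ker_normal[OF fin irr]])
  then have sub: "subgroup Z G" by (rule normal_imp_subgroup)
  have Zc: "Z \<subseteq> carrier G" using subgroup.subset[OF sub] .
  then have finZ: "finite Z" using fin finite_subset by blast
  have Zpos: "0 < card Z" using finZ subgroup.one_closed[OF sub] by (auto simp: card_gt_0_iff)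
  have onZ: "cmod (rep_char G \<rho> g) = n" if "g \<in> Z" for g
    using that unfolding Z_def char_center_def rep_char_one[OF irr]
    by (metis (mono_tags, lifting) mem_Collect_eq of_real_eq_iff of_real_of_nat_eq)
  have "real (Coset.order G) = (\<Sum>g\<in>carrier G. (cmod (rep_char G \<rho> g))\<^sup>2)"
    using irreducible_char_norm[OF fin irr] by (simp add: rep_char_apply)
  also have "\<dots> = (\<Sum>g\<in>carrier G - Z. (cmod (rep_char G \<rho> g))\<^sup>2) + (\<Sum>g\<in>Z. (cmod (rep_char G \<rho> g))\<^sup>2)"
    by (rule sum.subset_diff[OF Zc fin])
  also have "(\<Sum>g\<in>Z. (cmod (rep_char G \<rho> g))\<^sup>2) = real (card Z) * (real n)\<^sup>2"
    using onZ by simp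
  finally have *: "real (card (rcosets Z)) * real (card Z) =
      (\<Sum>g\<in>carrier G - Z. (cmod (rep_char G \<rho> g))\<^sup>2) + real (card Z) * (real n)\<^sup>2"
    using lagrange[OF sub] by (metis of_nat_mult)
  have "(\<forall>g\<in>carrier G - Z. rep_char G \<rho> g = 0) \<longleftrightarrow> (\<Sum>g\<in>carrier G - Z. (cmod (rep_char G \<rho> g))\<^sup>2) = 0"
    using fin by (subst sum_nonneg_eq_0_iff) auto
  also have "\<dots> \<longleftrightarrow> real (card (rcosets Z)) = (real n)\<^sup>2"
    using * Zpos by (auto simp: algebra_simps)
  also have "\<dots> \<longleftrightarrow> sqrt (real (card (rcosets Z))) = real n"
    by (metis of_nat_0_le_iff real_sqrt_pow2 real_sqrt_unique)
  also have "\<dots> \<longleftrightarrow> rep_char G \<rho> \<one> = complex_of_real (sqrt (real (card (rcosets Z))))"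
    unfolding rep_char_one[OF irr] by (metis of_real_eq_iff of_real_of_nat_eq)
  finally show ?thesis .
qed

section \<open>Groups with few characters of given kernel\<close>

text \<open>Only order \<open>p * p\<close> has to be excluded: if the order of \<open>x\<close>
  were larger, a power of \<open>x\<close>, again in the field, would have that order.\<close>

lemma prime_power_order_reduce:
  fixes x :: complex
  assumes "Factorial_Ring.prime p" "\<zeta> ^ p = 1" "x \<in> rat_adjoin \<zeta>" "x ^ (p ^ k) = 1"
  shows "x ^ p = 1"
  using assms(4)
proof (induction k)
  case (Suc k)
  show ?case
  proof (cases k)
    case (Suc j)
    have "(x ^ (p ^ j)) ^ (p * p) = 1"
      using Suc.prems Suc by (simp add: power_mult[symmetric] mult_ac)
    then have "(x ^ (p ^ j)) ^ p = 1"
      by (intro rat_adjoin_no_order_prime_square[OF assms(1,2) rat_adjoin_power[OF assms(3)]])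
    then have "x ^ (p ^ k) = 1" using Suc by (simp add: power_mult[symmetric] mult_ac)
    then show ?thesis by (rule Suc.IH)
  qed (use Suc in simp)
qed simp

lemma root_of_unity_coprime:
  fixes x :: complex
  assumes "x ^ a = 1" "x ^ b = 1" "coprime a b" "a \<noteq> 0"
  shows "x = 1"
proof -
  obtain g u v where "g dvd a" "g dvd b" "a * u = b * v + g"
    using bezout_add_strong_nat[of a b] assms(4) by auto
  moreover from this have "g = 1" using assms(3) coprime_common_divisor_nat by blast
  ultimately have "(x ^ a) ^ u = (x ^ b) ^ v * x" by (metis power_add power_mult power_one_right)
  then show ?thesis using assms by simp
qed

text \<open>The difference \<open>j - i\<close> is either \<open>p\<close> or prime to
  \<open>p\<close>, and in the latter case \<open>x = 1\<close>. The bound \<open>p\<close> is the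
  spread of the exponents \<open>1, ..., p - 1, p + 1\<close>.\<close>

lemma power_eq_imp_small_order:
  fixes x :: complex
  assumes p: "Factorial_Ring.prime p" and x: "x ^ (p ^ e) = 1" and ij: "i < j" "j - i \<le> p" and eq: "x ^ i = x ^ j"
  shows "x ^ p = 1"
proof -
  have p0: "0 < p" using p prime_gt_0_nat by blast
  have "x \<noteq> 0" using x p0 by (auto simp: power_0_left)
  moreover have "x ^ j = x ^ i * x ^ (j - i)" using ij by (simp add: power_add[symmetric])
  ultimately have d: "x ^ (j - i) = 1" using eq by simp
  show ?thesis
  proof (cases "j - i = p")
    case False
    then have "coprime (j - i) (p ^ e)"
      using p ij by (metis coprime_commute coprime_power_right_iff le_neq_implies_less nat_dvd_not_less prime_imp_coprime zero_less_diff)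
    then have "x = 1" using root_of_unity_coprime[OF d x] ij by auto
    then show ?thesis by simp
  qed (use d in simp)
qed

context group
begin

text \<open>Over the power \<open>\<lambda>\<^sup>k\<close> of a central character lies a character, and its kernel is unchanged
  because a larger kernel would meet \<open>Z(\<chi>)\<close> outside \<open>ker \<chi>\<close>, where \<open>\<lambda>\<^sup>k\<close> is faithful.\<close>

lemma irreducibles_over_power:
  assumes p: "Factorial_Ring.prime p" and ord: "Coset.order G = p ^ e" and irr: "irreducible_rep G n \<rho>"
  defines "N \<equiv> char_ker G (rep_char G \<rho>)"
  assumes sc: "\<And>z. z \<in> center_modulo G N \<Longrightarrow> \<rho> z = lam z \<cdot>\<^sub>m 1\<^sub>m n"
    and mult: "\<And>x y. x \<in> center_modulo G N \<Longrightarrow> y \<in> center_modulo G N \<Longrightarrow> lam (x \<otimes> y) = lam x * lam y"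
    and one: "lam \<one> = 1"
    and inv: "\<And>g z. g \<in> carrier G \<Longrightarrow> z \<in> center_modulo G N \<Longrightarrow> lam (g \<otimes> z \<otimes> inv g) = lam z"
    and ordl: "\<And>z. z \<in> center_modulo G N \<Longrightarrow> lam z ^ Coset.order G = 1"
    and ker: "\<And>z. z \<in> center_modulo G N \<Longrightarrow> lam z = 1 \<longleftrightarrow> z \<in> N"
    and k: "\<not> p dvd k"
  shows "\<exists>xs. xs \<noteq> [] \<and>
    (\<forall>\<chi>\<in>set xs. \<chi> \<in> Irr G \<and> char_ker G \<chi> = N \<and> \<chi> \<one> \<noteq> 0 \<and> (\<forall>z\<in>center_modulo G N. \<chi> z = \<chi> \<one> * lam z ^ k)) \<and>
    (\<forall>g\<in>carrier G - center_modulo G N. (\<Sum>\<chi>\<leftarrow>xs. \<chi> g) = 0)"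
proof -
  let ?Z = "center_modulo G N"
  have p0: "0 < p" using p prime_gt_0_nat by blast
  have fin: "finite (carrier G)" using ord p0 order_gt_0_iff_finite by simp
  have NG: "N \<lhd> G" unfolding N_def by (rule char_ker_normal[OF fin irr])
  have ZG: "?Z \<lhd> G" and NZ: "N \<subseteq> ?Z" by (rule center_modulo_normal[OF NG])+
  have Zc: "?Z \<subseteq> carrier G" by (auto simp: center_modulo_def)
  have Zpos: "0 < card ?Z"
    using finite_subset[OF Zc fin] subgroup.one_closed[OF normal_imp_subgroup[OF ZG]] by (auto simp: card_gt_0_iff)
  \<comment> \<open>The constituents of the character induced from \<open>lam ^ k\<close>; its value
    at \<open>\<one>\<close> is nonzero, so there is at least one.\<close>
  obtain rs where rs: "\<And>m \<sigma>. (m, \<sigma>) \<in> set rs \<Longrightarrow> irreducible_rep G m \<sigma>"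
    "\<And>m \<sigma> z. (m, \<sigma>) \<in> set rs \<Longrightarrow> z \<in> ?Z \<Longrightarrow> \<sigma> z = lam z ^ k \<cdot>\<^sub>m 1\<^sub>m m"
    "\<And>g. g \<in> carrier G \<Longrightarrow> of_nat (card ?Z) * (\<Sum>(m, \<sigma>)\<leftarrow>rs. mat_trace (\<sigma> g)) =
      (if g \<in> ?Z then of_nat (Coset.order G) * lam g ^ k else 0)"
    by (rule characters_over[OF fin ZG, of "\<lambda>z. lam z ^ k"]) (auto simp: mult one inv power_mult_distrib)
  have ne: "rs \<noteq> []"
  proof
    assume "rs = []"
    then have "of_nat (Coset.order G) * lam \<one> ^ k = 0"
      using rs(3)[OF one_closed] subgroup.one_closed[OF normal_imp_subgroup[OF ZG]] by simp
    then show False using one ord p0 by simp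
  qed
  have sum: "(\<Sum>(m, \<sigma>)\<leftarrow>rs. rep_char G \<sigma> g) = 0" if "g \<in> carrier G" "g \<notin> ?Z" for g
    using rs(3)[OF that(1)] that Zpos by (simp add: rep_char_apply case_prod_unfold)
  have char: "rep_char G \<sigma> \<in> Irr G \<and> char_ker G (rep_char G \<sigma>) = N \<and> rep_char G \<sigma> \<one> \<noteq> 0 \<and>
      (\<forall>z\<in>?Z. rep_char G \<sigma> z = rep_char G \<sigma> \<one> * lam z ^ k)" if mem: "(m, \<sigma>) \<in> set rs" for m \<sigma>
  proof -
    have m: "0 < m" using rs(1)[OF mem] by (simp add: irreducible_rep_def)
    have val: "rep_char G \<sigma> z = rep_char G \<sigma> \<one> * lam z ^ k" if z: "z \<in> ?Z" for z
      using rs(2)[OF mem z] subsetD[OF Zc z] by (simp add: rep_char_apply[of z] rep_char_one[OF rs(1)[OF mem]])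
    have KG: "char_ker G (rep_char G \<sigma>) \<lhd> G" by (rule char_ker_normal[OF fin rs(1)[OF mem]])
    have keq: "char_ker G (rep_char G \<sigma>) = {g \<in> carrier G. \<sigma> g = 1\<^sub>m m}" by (rule char_ker_eq[OF fin rs(1)[OF mem]])
    have sub: "N \<subseteq> char_ker G (rep_char G \<sigma>)"
    proof
      fix z assume "z \<in> N"
      then have z: "z \<in> ?Z" "lam z = 1" using NZ ker by auto
      then show "z \<in> char_ker G (rep_char G \<sigma>)" using rs(2)[OF mem z(1)] Zc by (auto simp: keq intro!: eq_matI)
    qed
    have "char_ker G (rep_char G \<sigma>) = N"
    proof (rule ccontr)
      assume "char_ker G (rep_char G \<sigma>) \<noteq> N"
      then have "N \<subset> char_ker G (rep_char G \<sigma>)" using sub by blast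
      then obtain x where x: "x \<in> char_ker G (rep_char G \<sigma>)" "x \<notin> N"
        "\<And>g. g \<in> carrier G \<Longrightarrow> g \<otimes> x \<otimes> inv g \<otimes> inv x \<in> N"
        using p_group_relative_center[OF p ord NG KG] by blast
      then have xZ: "x \<in> ?Z" by (auto simp: center_modulo_def keq)
      have "lam x ^ k \<cdot>\<^sub>m 1\<^sub>m m = 1 \<cdot>\<^sub>m (1\<^sub>m m :: complex mat)"
        using rs(2)[OF mem xZ] x(1) by (auto simp: keq intro!: eq_matI)
      then have "lam x ^ k = 1" using smult_one_mat_eq_iff[OF m] by blast
      moreover have "coprime k (p ^ e)" using p k by (metis coprime_commute coprime_power_right_iff prime_imp_coprime)
      moreover have "k \<noteq> 0" using k by (metis dvd_0_right)
      ultimately have "lam x = 1" using root_of_unity_coprime[of "lam x" k "p ^ e"] ordl[OF xZ] ord by simp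
      then show False using ker[OF xZ] x(2) by blast
    qed
    moreover have "rep_char G \<sigma> \<in> Irr G" using rs(1)[OF mem] unfolding Irr_eq by blast
    moreover have "rep_char G \<sigma> \<one> \<noteq> 0" using m by (simp add: rep_char_one[OF rs(1)[OF mem]])
    ultimately show ?thesis using val by blast
  qed
  let ?xs = "map (\<lambda>(m, \<sigma>). rep_char G \<sigma>) rs"
  have "?xs \<noteq> []" using ne by simp
  moreover have "\<forall>g\<in>carrier G - ?Z. (\<Sum>\<chi>\<leftarrow>?xs. \<chi> g) = 0"
    using sum by (simp add: case_prod_unfold o_def)
  moreover have "\<forall>\<chi>\<in>set ?xs. \<chi> \<in> Irr G \<and> char_ker G \<chi> = N \<and> \<chi> \<one> \<noteq> 0 \<and> (\<forall>z\<in>?Z. \<chi> z = \<chi> \<one> * lam z ^ k)"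
    using char by auto
  ultimately show ?thesis by blast
qed

text \<open>Two counts in the set \<open>S\<close> of characters with kernel \<open>N\<close> would
  reach \<open>p\<close>: one if \<open>lam\<close> had order above \<open>p\<close>, the other if a
  nontrivial \<open>lam\<close> had a second character with kernel \<open>N\<close> over it.\<close>

lemma CM_group_imp_vanishing:
  assumes p: "Factorial_Ring.prime p" and ord: "Coset.order G = p ^ e"
    and CM: "CM_group (p - 1) G" and irr: "irreducible_rep G n \<rho>"
  defines "Z \<equiv> char_center G (rep_char G \<rho>)"
  shows "\<And>g. g \<in> carrier G \<Longrightarrow> g \<notin> Z \<Longrightarrow> rep_char G \<rho> g = 0"
    and "\<And>z. z \<in> Z \<Longrightarrow> \<exists>c. c ^ p = 1 \<and> rep_char G \<rho> z = of_nat n * c"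
proof -
  have p1: "1 < p" using p prime_gt_1_nat by blast
  have fin: "finite (carrier G)" using ord p1 order_gt_0_iff_finite by simp
  define N where "N = char_ker G (rep_char G \<rho>)"
  have NG: "N \<lhd> G" unfolding N_def by (rule char_ker_normal[OF fin irr])
  have Z: "Z = center_modulo G N" unfolding Z_def N_def by (rule char_center_eq[OF fin irr])
  obtain lam where sc: "\<And>z. z \<in> Z \<Longrightarrow> \<rho> z = lam z \<cdot>\<^sub>m 1\<^sub>m n"
    and val: "\<And>z. z \<in> Z \<Longrightarrow> rep_char G \<rho> z = of_nat n * lam z"
    and mult: "\<And>x y. x \<in> Z \<Longrightarrow> y \<in> Z \<Longrightarrow> lam (x \<otimes> y) = lam x * lam y" and one: "lam \<one> = 1"
    and inv: "\<And>g z. g \<in> carrier G \<Longrightarrow> z \<in> Z \<Longrightarrow> lam (g \<otimes> z \<otimes> inv g) = lam z"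
    and ordl: "\<And>z. z \<in> Z \<Longrightarrow> lam z ^ Coset.order G = 1"
    and ker: "\<And>z. z \<in> Z \<Longrightarrow> lam z = 1 \<longleftrightarrow> z \<in> N"
    by (rule central_character[OF fin irr, folded N_def, folded Z]) (rule that; assumption)
  define S where "S = {\<chi> \<in> Irr G. char_ker G \<chi> = N}"
  have S: "finite S" "card S \<le> p - 1" using CM NG unfolding CM_group_def S_def by auto
  have chiS: "rep_char G \<rho> \<in> S" using irr unfolding S_def N_def Irr_eq by blast
  have over: "\<exists>xs. xs \<noteq> [] \<and> (\<forall>\<chi>\<in>set xs. \<chi> \<in> Irr G \<and> char_ker G \<chi> = N \<and> \<chi> \<one> \<noteq> 0 \<and> (\<forall>z\<in>Z. \<chi> z = \<chi> \<one> * lam z ^ k)) \<and>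
    (\<forall>g\<in>carrier G - Z. (\<Sum>\<chi>\<leftarrow>xs. \<chi> g) = 0)" if k: "\<not> p dvd k" for k
    by (rule irreducibles_over_power[OF p ord irr, folded N_def, folded Z]) (fact sc mult one inv ordl ker k)+
  have "\<exists>\<chi>. \<chi> \<in> S \<and> \<chi> \<one> \<noteq> 0 \<and> (\<forall>z\<in>Z. \<chi> z = \<chi> \<one> * lam z ^ k)" if k: "\<not> p dvd k" for k
    using over[OF k] unfolding S_def by (metis (mono_tags, lifting) hd_in_set mem_Collect_eq)
  then obtain \<Psi> where \<Psi>: "\<And>k. \<not> p dvd k \<Longrightarrow> \<Psi> k \<in> S \<and> \<Psi> k \<one> \<noteq> 0 \<and> (\<forall>z\<in>Z. \<Psi> k z = \<Psi> k \<one> * lam z ^ k)"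
    by metis
  have lam_p: "lam z ^ p = 1" if z: "z \<in> Z" for z
  proof (rule ccontr)
    assume ne: "lam z ^ p \<noteq> 1"
    \<comment> \<open>These are \<open>p\<close> exponents prime to \<open>p\<close>, any two of
      which differ by at most \<open>p\<close>.\<close>
    define K where "K = insert (p + 1) {1..<p}"
    have "\<not> p dvd Suc p" using dvd_diff_nat[of p "Suc p" p] p1 by auto
    then have nd: "\<not> p dvd k" if "k \<in> K" for k
      using that by (auto simp: K_def dest: dvd_imp_le)
    have "inj_on \<Psi> K"
    proof (rule linorder_inj_onI)
      fix i j assume ij: "i < j" "i \<in> K" "j \<in> K"
      show "\<Psi> i \<noteq> \<Psi> j"
      proof
        assume eq: "\<Psi> i = \<Psi> j"
        then have "lam z ^ i = lam z ^ j" using \<Psi>[OF nd[OF ij(2)]] \<Psi>[OF nd[OF ij(3)]] z by (metis mult_cancel_left)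
        moreover have "j - i \<le> p" using ij by (auto simp: K_def)
        ultimately show False
          using power_eq_imp_small_order[OF p, of "lam z" e i j] ordl[OF z] ord ij(1) ne by simp
      qed
    qed auto
    then have "card (\<Psi> ` K) = p" using p1 by (simp add: card_image K_def)
    moreover have "\<Psi> ` K \<subseteq> S" using \<Psi> nd by blast
    ultimately show False using S card_mono[of S "\<Psi> ` K"] p1 by simp
  qed
  show "\<exists>c. c ^ p = 1 \<and> rep_char G \<rho> z = of_nat n * c" if "z \<in> Z" for z
    using lam_p[OF that] val[OF that] by blast
  have uniq: "\<chi> = rep_char G \<rho>"
    if chi: "\<chi> \<in> S" "\<chi> \<one> \<noteq> 0" "\<And>z. z \<in> Z \<Longrightarrow> \<chi> z = \<chi> \<one> * lam z" and z0: "z0 \<in> Z" "z0 \<notin> N" for \<chi> z0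
  proof (rule ccontr)
    assume ne: "\<chi> \<noteq> rep_char G \<rho>"
    have n: "of_nat n \<noteq> (0::complex)" using irr by (simp add: irreducible_rep_def)
    have x: "lam z0 \<noteq> 1" "lam z0 ^ p = 1" using ker lam_p z0 by auto
    have x0: "lam z0 \<noteq> 0" using x p1 by (auto simp: power_0_left)
    have pw: "lam z0 ^ i \<noteq> lam z0 ^ j" if "i < j" "j < p" for i j
    proof
      assume "lam z0 ^ i = lam z0 ^ j"
      moreover have "lam z0 ^ j = lam z0 ^ i * lam z0 ^ (j - i)" using that by (simp add: power_add[symmetric])
      ultimately have "lam z0 ^ (j - i) = 1" using x0 by simp
      moreover have "coprime (j - i) p"
        using p that by (metis coprime_commute less_imp_diff_less nat_dvd_not_less prime_imp_coprime zero_less_diff)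
      ultimately show False using root_of_unity_coprime[of "lam z0" "j - i" p] x that by simp
    qed
    have nd: "\<not> p dvd k" if "k \<in> {2..<p}" for k
      using that by (auto dest: dvd_imp_le)
    \<comment> \<open>The quotient of the values at \<open>z0\<close> and \<open>\<one>\<close>
      recovers the exponent. It is 1 for \<open>\<chi>\<close> and for the given character, so they
      are two further elements of \<open>S\<close> beside the \<open>p - 2\<close> characters
      \<open>\<Psi> k\<close>.\<close>
    have ratio: "\<Psi> k z0 / \<Psi> k \<one> = lam z0 ^ k" if "k \<in> {2..<p}" for k
      using \<Psi>[OF nd[OF that]] z0 by simp
    have r1: "\<chi> z0 / \<chi> \<one> = lam z0 ^ 1" using chi z0 by simp
    have r2: "rep_char G \<rho> z0 / rep_char G \<rho> \<one> = lam z0 ^ 1" using val[OF z0(1)] n by (simp add: rep_char_one[OF irr])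
    have "inj_on \<Psi> {2..<p}"
    proof (rule linorder_inj_onI)
      fix i j assume ij: "i < j" "i \<in> {2..<p}" "j \<in> {2..<p}"
      then show "\<Psi> i \<noteq> \<Psi> j" using ratio[OF ij(2)] ratio[OF ij(3)] pw[OF ij(1)] by auto
    qed auto
    then have "card (\<Psi> ` {2..<p}) = p - 2" by (simp add: card_image)
    moreover have "\<chi> \<notin> \<Psi> ` {2..<p}" "rep_char G \<rho> \<notin> \<Psi> ` {2..<p}"
      using ratio r1 r2 pw[of 1] by (metis (no_types, lifting) Suc_1 atLeastLessThan_iff image_iff lessI less_le_trans)+
    ultimately have "card (insert \<chi> (insert (rep_char G \<rho>) (\<Psi> ` {2..<p}))) = p" using ne p1 by simp
    moreover have "insert \<chi> (insert (rep_char G \<rho>) (\<Psi> ` {2..<p})) \<subseteq> S" using \<Psi> nd chi chiS by blast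
    ultimately show False using S card_mono[of S "insert \<chi> (insert (rep_char G \<rho>) (\<Psi> ` {2..<p}))"] p1 by simp
  qed
  show "rep_char G \<rho> g = 0" if g: "g \<in> carrier G" "g \<notin> Z" for g
  proof (cases "Z \<subseteq> N")
    \<comment> \<open>If \<open>N\<close> were proper, the nontrivial \<open>p\<close>-group
      \<open>G Mod N\<close> would have a nontrivial center. So \<open>Z\<close> is the whole group
      and nothing remains to be shown.\<close>
    case True
    have "N = carrier G"
    proof (rule ccontr)
      assume "N \<noteq> carrier G"
      then have "N \<subset> carrier G" unfolding N_def by (auto simp: char_ker_def)
      then obtain x where "x \<in> carrier G" "x \<notin> N" "\<And>g. g \<in> carrier G \<Longrightarrow> g \<otimes> x \<otimes> inv g \<otimes> inv x \<in> N"
        using p_group_relative_center[OF p ord NG normal_self] by blast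
      then show False using True unfolding Z center_modulo_def by blast
    qed
    then have "Z = carrier G" using center_modulo_normal(2)[OF NG] unfolding Z center_modulo_def by auto
    then show ?thesis using g by blast
  next
    case False
    then obtain z0 where z0: "z0 \<in> Z" "z0 \<notin> N" by blast
    have k1: "\<not> p dvd 1" using p1 by simp
    obtain xs where xs: "xs \<noteq> []" "\<And>\<chi>. \<chi> \<in> set xs \<Longrightarrow> \<chi> \<in> S" "\<And>\<chi>. \<chi> \<in> set xs \<Longrightarrow> \<chi> \<one> \<noteq> 0"
      "\<And>\<chi> z. \<chi> \<in> set xs \<Longrightarrow> z \<in> Z \<Longrightarrow> \<chi> z = \<chi> \<one> * lam z ^ 1"
      "\<And>g. g \<in> carrier G - Z \<Longrightarrow> (\<Sum>\<chi>\<leftarrow>xs. \<chi> g) = 0"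
      using over[OF k1] unfolding S_def by auto
    \<comment> \<open>All constituents over \<open>lam\<close> are the given character, so a
      positive multiple of it vanishes off \<open>Z\<close>.\<close>
    have eq: "\<chi> = rep_char G \<rho>" if chi: "\<chi> \<in> set xs" for \<chi>
      by (rule uniq[OF xs(2,3)[OF chi] _ z0]) (use xs(4)[OF chi] in simp)
    have "(\<Sum>\<chi>\<leftarrow>xs. \<chi> g) = (\<Sum>\<chi>\<leftarrow>xs. rep_char G \<rho> g)"
      using eq by (intro arg_cong[of _ _ sum_list] map_cong) auto
    then have "of_nat (length xs) * rep_char G \<rho> g = 0" using xs(5)[of g] g by (simp add: sum_list_triv)
    then show ?thesis using xs(1) by simp
  qed
qed

text \<open>A character with kernel \<open>N\<close> vanishes off \<open>Z\<close> and is
  \<open>d * lam\<close> on \<open>Z\<close>, so \<open>lam\<close> determines it. The values of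
  \<open>lam\<close> are \<open>p\<close>-th roots of unity and its kernel is \<open>N\<close>, so
  \<open>lam\<close> is determined by its value at one \<open>z0\<close> outside \<open>N\<close>,
  for which there are \<open>p - 1\<close> choices.\<close>

lemma vanishing_imp_CM_group:
  assumes p: "Factorial_Ring.prime p" and ord: "Coset.order G = p ^ e"
    and van: "\<And>n \<rho> g. irreducible_rep G n \<rho> \<Longrightarrow> g \<in> carrier G - char_center G (rep_char G \<rho>) \<Longrightarrow> rep_char G \<rho> g = 0"
    and deg: "\<And>n \<rho>. irreducible_rep G n \<rho> \<Longrightarrow>
      rep_char G \<rho> \<one> = complex_of_real (sqrt (real (card (rcosets (char_center G (rep_char G \<rho>))))))"
    and val: "\<And>n \<rho> g. irreducible_rep G n \<rho> \<Longrightarrow> g \<in> carrier G \<Longrightarrow> rep_char G \<rho> g \<in> rat_adjoin \<zeta>"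
    and zeta: "\<zeta> ^ p = 1"
  shows "CM_group (p - 1) G"
proof -
  have p1: "1 < p" using p prime_gt_1_nat by blast
  have fin: "finite (carrier G)" using ord p1 order_gt_0_iff_finite by simp
  have "finite {\<chi> \<in> Irr G. char_ker G \<chi> = N} \<and> card {\<chi> \<in> Irr G. char_ker G \<chi> = N} \<le> p - 1"
    if NG: "N \<lhd> G" for N
  proof -
    define S where "S = {\<chi> \<in> Irr G. char_ker G \<chi> = N}"
    define Z where "Z = center_modulo G N"
    \<comment> \<open>The common degree of the characters with kernel \<open>N\<close>: it depends
      only on \<open>Z\<close>, hence only on \<open>N\<close>.\<close>
    define d where "d = complex_of_real (sqrt (real (card (rcosets Z))))"
    have Zsub: "subgroup Z G" unfolding Z_def by (rule normal_imp_subgroup[OF center_modulo_normal(1)[OF NG]])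
    have Zc: "z \<in> carrier G" if "z \<in> Z" for z using that by (simp add: Z_def center_modulo_def)
    have "0 < card (rcosets Z)" using lagrange[OF Zsub] ord p1 by (metis gr0I mult_0 power_not_zero not_one_less_zero)
    then have d0: "d \<noteq> 0" by (simp add: d_def)
    define P where "P \<chi> lam \<longleftrightarrow> (\<forall>z\<in>Z. \<chi> z = d * lam z \<and> lam z ^ p = 1 \<and> (lam z = 1 \<longleftrightarrow> z \<in> N)) \<and>
        (\<forall>x\<in>Z. \<forall>y\<in>Z. lam (x \<otimes> y) = lam x * lam y)" for \<chi> lam
    have lamE: "\<exists>lam. P \<chi> lam" if S: "\<chi> \<in> S" for \<chi>
    proof -
      obtain n \<rho> where irr: "irreducible_rep G n \<rho>" and chi: "\<chi> = rep_char G \<rho>" and N: "N = char_ker G (rep_char G \<rho>)"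
        using S unfolding S_def Irr_eq by blast
      obtain lam where lam: "\<And>z. z \<in> Z \<Longrightarrow> rep_char G \<rho> z = of_nat n * lam z"
        "\<And>x y. x \<in> Z \<Longrightarrow> y \<in> Z \<Longrightarrow> lam (x \<otimes> y) = lam x * lam y"
        "\<And>z. z \<in> Z \<Longrightarrow> lam z ^ Coset.order G = 1"
        "\<And>z. z \<in> Z \<Longrightarrow> lam z = 1 \<longleftrightarrow> z \<in> N"
        by (rule central_character[OF fin irr, folded N, folded Z_def]) (rule that; assumption)
      have dn: "d = of_nat n"
        using deg[OF irr] unfolding rep_char_one[OF irr] char_center_eq[OF fin irr] N[symmetric] Z_def[symmetric] d_def by simp
      have "lam z ^ p = 1" if z: "z \<in> Z" for z
      proof (rule prime_power_order_reduce[OF p zeta])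
        have "lam z = rep_char G \<rho> z / of_nat n" using lam(1)[OF z] d0 dn by simp
        then show "lam z \<in> rat_adjoin \<zeta>"
          using val[OF irr Zc[OF z]] d0 dn by (simp add: rat_adjoin_divide rat_adjoin_of_nat)
        show "lam z ^ (p ^ e) = 1" using lam(3)[OF z] ord by simp
      qed
      then have "P \<chi> lam" using lam dn chi unfolding P_def by auto
      then show ?thesis by blast
    qed
    define L where "L \<chi> = (SOME lam. P \<chi> lam)" for \<chi>
    have "P \<chi> (L \<chi>)" if "\<chi> \<in> S" for \<chi> unfolding L_def by (rule someI_ex[OF lamE[OF that]])
    then have L: "\<And>\<chi> z. \<chi> \<in> S \<Longrightarrow> z \<in> Z \<Longrightarrow> \<chi> z = d * L \<chi> z"
      "\<And>\<chi> z. \<chi> \<in> S \<Longrightarrow> z \<in> Z \<Longrightarrow> L \<chi> z ^ p = 1"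
      "\<And>\<chi> z. \<chi> \<in> S \<Longrightarrow> z \<in> Z \<Longrightarrow> L \<chi> z = 1 \<longleftrightarrow> z \<in> N"
      "\<And>\<chi> x y. \<chi> \<in> S \<Longrightarrow> x \<in> Z \<Longrightarrow> y \<in> Z \<Longrightarrow> L \<chi> (x \<otimes> y) = L \<chi> x * L \<chi> y"
      unfolding P_def by blast+
    have determined: "\<chi> = \<chi>'" if S: "\<chi> \<in> S" "\<chi>' \<in> S" and eq: "\<And>z. z \<in> Z \<Longrightarrow> L \<chi> z = L \<chi>' z" for \<chi> \<chi>'
    proof
      fix g
      \<comment> \<open>Outside the carrier every character has the value \<open>undefined\<close>,
        so agreement on \<open>Z\<close> yields equality of functions.\<close>
      have off: "\<chi> g = (if g \<in> carrier G then 0 else undefined)" if S: "\<chi> \<in> S" and g: "g \<notin> Z" for \<chi>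
      proof -
        obtain n \<rho> where irr: "irreducible_rep G n \<rho>" and chi: "\<chi> = rep_char G \<rho>" and N: "N = char_ker G (rep_char G \<rho>)"
          using S unfolding S_def Irr_eq by blast
        show ?thesis
          using van[OF irr, of g] g unfolding char_center_eq[OF fin irr] N[symmetric] Z_def[symmetric] chi
          by (auto simp: rep_char_def)
      qed
      show "\<chi> g = \<chi>' g"
        using off[OF S(1)] off[OF S(2)] L(1)[OF S(1)] L(1)[OF S(2)] eq by (cases "g \<in> Z") auto
    qed
    show ?thesis
    proof (cases "Z \<subseteq> N")
      \<comment> \<open>Every \<open>L \<chi>\<close> is trivial on \<open>Z\<close> here, so there
        is at most one character, and \<open>1 \<le> p - 1\<close>.\<close>
      case True
      have "\<chi> = \<chi>'" if "\<chi> \<in> S" "\<chi>' \<in> S" for \<chi> \<chi>'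
      proof (rule determined[OF that])
        fix z assume z: "z \<in> Z"
        then show "L \<chi> z = L \<chi>' z" using L(3)[OF that(1) z] L(3)[OF that(2) z] True by auto
      qed
      then have "S = {} \<or> (\<exists>\<chi>. S = {\<chi>})" by blast
      then show ?thesis using p1 unfolding S_def[symmetric] by auto
    next
      case False
      then obtain z0 where z0: "z0 \<in> Z" "z0 \<notin> N" by blast
      define R where "R = {x::complex. x ^ p = 1} - {1}"
      have finR: "finite {x::complex. x ^ p = 1}" "card {x::complex. x ^ p = 1} = p"
        using p1 card_roots_unity_eq[of p] by (auto intro!: finite_roots_unity)
      then have R: "finite R" "card R = p - 1" by (auto simp: R_def card_Diff_singleton)
      have im: "(\<lambda>\<chi>. L \<chi> z0) ` S \<subseteq> R" using L(2,3) z0 by (auto simp: R_def)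
      have inj: "inj_on (\<lambda>\<chi>. L \<chi> z0) S"
      proof (rule inj_onI)
        fix \<chi> \<chi>' assume S: "\<chi> \<in> S" "\<chi>' \<in> S" and eq: "L \<chi> z0 = L \<chi>' z0"
        have powZ: "z0 [^] (j::nat) \<in> Z" for j
          using z0 Zsub by (induction j) (auto simp: subgroup.one_closed subgroup.m_closed)
        have Lpow: "L \<psi> (z0 [^] (j::nat)) = L \<psi> z0 ^ j" if psi: "\<psi> \<in> S" for \<psi> j
        proof (induction j)
          case 0
          have "\<one> \<in> N" using subgroup.one_closed[OF normal_imp_subgroup[OF NG]] .
          then show ?case using L(3)[OF psi subgroup.one_closed[OF Zsub]] by simp
        next
          case (Suc j)
          then show ?case using L(4)[OF psi powZ[of j] z0(1)] by simp
        qed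
        show "\<chi> = \<chi>'"
        proof (rule determined[OF S])
          fix z assume z: "z \<in> Z"
          have ne: "L \<chi> z0 \<noteq> 1" using L(3)[OF S(1) z0(1)] z0 by blast
          \<comment> \<open>\<open>L \<chi> z0\<close> generates the \<open>p\<close>-th roots of
            unity, so \<open>z\<close> differs from a power of \<open>z0\<close> by some
            \<open>w\<close> on which \<open>L \<chi>\<close> is 1. Such \<open>w\<close> lies in
            the common kernel \<open>N\<close>, where \<open>L \<chi>'\<close> is 1 as well.\<close>
          obtain j where j: "L \<chi> z = L \<chi> z0 ^ j"
            using prime_root_of_unity_powers[OF p L(2)[OF S(1) z0(1)] ne L(2)[OF S(1) z]] by blast
          define w where "w = z \<otimes> inv (z0 [^] j)"
          have w: "w \<in> Z" using z powZ Zsub unfolding w_def by (simp add: subgroup.m_closed subgroup.m_inv_closed)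
          have zw: "z = w \<otimes> z0 [^] j" using Zc[OF z] Zc[OF z0(1)] by (simp add: w_def m_assoc)
          have e: "L \<psi> z = L \<psi> w * L \<psi> z0 ^ j" if "\<psi> \<in> S" for \<psi>
            using L(4)[OF that w powZ[of j]] Lpow[OF that] zw by simp
          have "L \<chi> z0 \<noteq> 0" using L(2)[OF S(1) z0(1)] p1 by (auto simp: power_0_left)
          then have "L \<chi> w = 1" using e[OF S(1)] j by simp
          then have "w \<in> N" using L(3)[OF S(1) w] by blast
          then have "L \<chi>' w = 1" using L(3)[OF S(2) w] by blast
          then show "L \<chi> z = L \<chi>' z" using e[OF S(2)] j eq by simp
        qed
      qed
      have "finite S" using inj_on_finite[OF inj im R(1)] .
      moreover have "card S \<le> p - 1" using card_inj_on_le[OF inj im R(1)] R(2) by simp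
      ultimately show ?thesis unfolding S_def by blast
    qed
  qed
  then show ?thesis unfolding CM_group_def using fin is_group by blast
qed

end

theorem theorem3:
  fixes p :: nat and G :: "('a, 'b) monoid_scheme" and \<zeta> :: complex
  assumes "Factorial_Ring.prime p"
    and "group G" and "finite (carrier G)" and "\<exists>k. Coset.order G = p ^ k"
    and "primitive_root_of_unity p \<zeta>"
  shows "CM_group (p - 1) G \<longleftrightarrow>
           GVZ_group G \<and> (\<forall>\<chi>\<in>Irr G. \<forall>g\<in>carrier G. \<chi> g \<in> rat_adjoin \<zeta>)"
proof -
  interpret group G by (rule assms(2))
  note p = assms(1) and fin = assms(3)
  have p1: "1 < p" using p prime_gt_1_nat by blast
  obtain e where ord: "Coset.order G = p ^ e" using assms(4) by blast
  have zeta: "\<zeta> ^ p = 1" "\<zeta> \<noteq> 1"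
    using assms(5) p1 unfolding primitive_root_of_unity_def by (auto dest: spec[of _ 1])
  \<comment> \<open>This turns the GVZ condition into vanishing off the center, the form in which
    both directions are proved.\<close>
  have deg_iff: "rep_char G \<rho> \<one>\<^bsub>G\<^esub> = complex_of_real (sqrt (real (card (rcosets\<^bsub>G\<^esub> (char_center G (rep_char G \<rho>)))))) \<longleftrightarrow>
      (\<forall>g\<in>carrier G - char_center G (rep_char G \<rho>). rep_char G \<rho> g = 0)"
    if "irreducible_rep G n \<rho>" for n \<rho>
    using vanishing_iff_index[OF fin that] by simp
  show ?thesis
  proof
    assume CM: "CM_group (p - 1) G"
    note van = CM_group_imp_vanishing[OF p ord CM]
    have "GVZ_group G"
      unfolding GVZ_group_def Irr_eq using is_group fin deg_iff van(1) by blast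
    moreover have "\<chi> g \<in> rat_adjoin \<zeta>" if chi: "\<chi> \<in> Irr G" and g: "g \<in> carrier G" for \<chi> g
    proof -
      obtain n \<rho> where irr: "irreducible_rep G n \<rho>" and \<chi>: "\<chi> = rep_char G \<rho>" using chi unfolding Irr_eq by blast
      show ?thesis
      proof (cases "g \<in> char_center G \<chi>")
        case True
        then obtain c where c: "c ^ p = 1" "\<chi> g = of_nat n * c" using van(2)[OF irr] \<chi> by blast
        obtain k where "c = \<zeta> ^ k" using prime_root_of_unity_powers[OF p zeta c(1)] by blast
        then show ?thesis
          using c(2) by (simp add: rat_adjoin_mult rat_adjoin_of_nat rat_adjoin_power rat_adjoin_self)
      next
        case False
        then have "\<chi> g = of_nat 0" using van(1)[OF irr g] \<chi> by simp
        then show ?thesis using rat_adjoin_of_nat[of 0 \<zeta>] by simp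
      qed
    qed
    ultimately show "GVZ_group G \<and> (\<forall>\<chi>\<in>Irr G. \<forall>g\<in>carrier G. \<chi> g \<in> rat_adjoin \<zeta>)" by blast
  next
    assume R: "GVZ_group G \<and> (\<forall>\<chi>\<in>Irr G. \<forall>g\<in>carrier G. \<chi> g \<in> rat_adjoin \<zeta>)"
    have Irr: "rep_char G \<rho> \<in> Irr G" if "irreducible_rep G n \<rho>" for n \<rho> using that unfolding Irr_eq by blast
    have deg: "rep_char G \<rho> \<one>\<^bsub>G\<^esub> = complex_of_real (sqrt (real (card (rcosets\<^bsub>G\<^esub> (char_center G (rep_char G \<rho>))))))"
      if "irreducible_rep G n \<rho>" for n \<rho>
      using R Irr[OF that] unfolding GVZ_group_def by blast
    show "CM_group (p - 1) G"
    proof (rule vanishing_imp_CM_group[OF p ord _ _ _ zeta(1)])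
      show "rep_char G \<rho> g = 0" if "irreducible_rep G n \<rho>" "g \<in> carrier G - char_center G (rep_char G \<rho>)" for n \<rho> g
        using deg_iff[OF that(1)] deg[OF that(1)] that(2) by blast
    qed (use deg R Irr in blast)+
  qed
qed

end
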